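(* Let $\nu,d\in\mathbb{N}$, let $\Psi$ be a real symmetric positive definite $\nu\times\nu$ matrix, let $\Sigma$ be a real symmetric positive definite $d\times d$ matrix. For a constant initial condition in $\mathbb{R}^{\nu\times d}$, let $(\mathfrak{X}_t)_{t\ge 0}$ be the matrix Ornstein--Uhlenbeck process solving $$\mathrm{d}\mathfrak{X}_t=-\mathfrak{X}_t\,\mathrm{d}t+\sqrt{2}\,\Psi^{1/2}\,\mathrm{d}\mathfrak{B}_t\,\Sigma^{1/2},$$ where $(\mathfrak{B}_t)_{t\ge0}$ is a $\nu\times d$ matrix of independent standard Brownian motions. Then: (i) for every $X\in\mathbb{R}^{\nu\times d}$ and $t>0$, $$\mathfrak{X}_t\mid\{\mathfrak{X}_0=X\}\sim\mathcal{N}_{\nu\times d}\big(e^{-t}X,(1-e^{-2t})(\Psi\otimes\Sigma)\big),$$ and the stationary limiting distribution (limit in law as $t\to\infty$) of $(\mathfrak{X}_t)_{t\ge0}$ is that of $\mathfrak{X}_\infty\sim\mathcal{N}_{\nu\times d}(0_{\nu\times d},\Psi\otimes\Sigma)$; (ii) for $\mathfrak{Z}\sim\mathcal{N}_{\nu\times d}(0_{\nu\times d},I_\nu\otimes I_d)$, the transition semigroup satisfies, for measurable $h$ for which the expectation is finite, $$\mathcal{P}^{\mathrm{OU}}_t h(X)=\mathsf{E}\big[h\big(e^{-t}X+\sqrt{1-e^{-2t}}\,\Psi^{1/2}\mathfrak{Z}\Sigma^{1/2}\big)\big];$$ (iii) for $\gamma=\mathcal{N}_{\nu\times d}(0_{\nu\times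 d},\Psi\otimes\Sigma)$ one has the invariance $\gamma\,\mathcal{P}^{\mathrm{OU}}_t=\gamma$ for all $t\ge0$.
   Context: A random matrix $\mathfrak{N}$ in $\mathbb{R}^{\nu\times d}$ has the matrix normal law $\mathcal{N}_{\nu\times d}(M,\Psi\otimes\Sigma)$ if $\mathrm{vec}(\mathfrak{N}^\top)\sim\mathcal{N}_{\nu d}(\mathrm{vec}(M^\top),\Psi\otimes\Sigma)$, where $\mathrm{vec}$ stacks the columns of a matrix and $\otimes$ is the Kronecker product. $S^{1/2}$ denotes the symmetric square root. $0_{\nu\times d}$ is the zero matrix and $I_d$ the identity. $(\mathcal{P}^{\mathrm{OU}}_t)_{t\ge0}$ is the transition semigroup of the process, with transition kernel $P_t(X,\mathrm{d}Y)$: $(\mathcal{P}^{\mathrm{OU}}_th)(X)=\int h(Y)\,P_t(X,\mathrm{d}Y)=\mathsf{E}[h(\mathfrak{X}_t)\mid\mathfrak{X}_0=X]$. For a probability measure $\mu$ on $\mathbb{R}^{\nu\times d}$, the measure $\mu\,\mathcal{P}^{\mathrm{OU}}_t$ is defined by $(\mu\,\mathcal{P}^{\mathrm{OU}}_t)(A)=\int P_t(X,A)\,\mu(\mathrm{d}X)$ for Borel $A\subseteq\mathbb{R}^{\nu\times d}$. *)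

theory Defs
  imports "HOL-Probability.Probability"
begin

text \<open>Matrices in \<open>\<real>\<^sup>\<nu>\<^sup>\<times>\<^sup>d\<close> have type \<open>real^'d^'nu\<close>: rows are indexed by \<open>'nu\<close> and columns by \<open>'d\<close>.\<close>

definition sym_posdef :: "real^'k^'k \<Rightarrow> bool" where
  "sym_posdef S \<longleftrightarrow> transpose S = S \<and> (\<forall>v. v \<noteq> 0 \<longrightarrow> v \<bullet> (S *v v) > 0)"

definition sym_possemidef :: "real^'k^'k \<Rightarrow> bool" where
  "sym_possemidef S \<longleftrightarrow> transpose S = S \<and> (\<forall>v. v \<bullet> (S *v v) \<ge> 0)"

definition sym_sqrt :: "real^'k^'k \<Rightarrow> real^'k^'k" where
  "sym_sqrt S = (THE R. sym_possemidef R \<and> R ** R = S)"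

text \<open>The index set \<open>{1..\<nu>d}\<close> of a stacked vector is represented by pairs; the first component
  is the position of the block (the column being stacked), the second the position inside it.
  The Kronecker product uses the same convention for its rows and its columns.\<close>

definition vec_cols :: "'a^'c^'r \<Rightarrow> 'a^('c \<times> 'r)" where
  "vec_cols A = (\<chi> p. A $ snd p $ fst p)"

definition kron :: "real^'b^'a \<Rightarrow> real^'d^'c \<Rightarrow> real^('b \<times> 'd)^('a \<times> 'c)" where
  "kron P S = (\<chi> p q. P $ fst p $ fst q * S $ snd p $ snd q)"

text \<open>The normal law with mean \<open>m\<close> and covariance matrix \<open>C\<close>, given by its Lebesgue density.
  Only meaningful for symmetric positive definite \<open>C\<close>, the only case in which it is used.\<close>

definition multivariate_normal :: "real^'k \<Rightarrow> real^'k^'k \<Rightarrow> (real^'k) measure" where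
  "multivariate_normal m C = density lborel (\<lambda>x. ennreal
     (exp (- ((x - m) \<bullet> (matrix_inv C *v (x - m))) / 2) / sqrt ((2 * pi) ^ CARD('k) * det C)))"

definition has_matrix_normal_law ::
    "'w measure \<Rightarrow> ('w \<Rightarrow> real^'d^'nu) \<Rightarrow> real^'d^'nu \<Rightarrow> real^('nu \<times> 'd)^('nu \<times> 'd) \<Rightarrow> bool" where
  "has_matrix_normal_law P N A C \<longleftrightarrow> N \<in> borel_measurable P \<and>
     distr P borel (\<lambda>\<omega>. vec_cols (transpose (N \<omega>))) = multivariate_normal (vec_cols (transpose A)) C"

text \<open>The law itself, as a measure on matrices: the image of the normal law on
  \<open>\<real>\<^sup>\<nu>\<^sup>d\<close> under the inverse of \<open>N \<mapsto> vec (N\<^sup>T)\<close>.\<close>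

definition matrix_normal ::
    "real^'d^'nu \<Rightarrow> real^('nu \<times> 'd)^('nu \<times> 'd) \<Rightarrow> (real^'d^'nu) measure" where
  "matrix_normal A C =
     distr (multivariate_normal (vec_cols (transpose A)) C) borel (\<lambda>v. \<chi> i j. v $ (i, j))"

lemma vec_cols_transpose_nth: "vec_cols (transpose N) $ (i, j) = N $ i $ j"
  by (simp add: vec_cols_def transpose_def)

lemma borel_measurable_vec_lambda:
  fixes f :: "'w \<Rightarrow> 'k::finite \<Rightarrow> 'b::euclidean_space"
  assumes "\<And>k. (\<lambda>x. f x k) \<in> borel_measurable P"
  shows "(\<lambda>x. \<chi> k. f x k) \<in> borel_measurable P"
  by (rule borel_measurable_euclidean_space[THEN iffD2])
     (auto simp: Basis_vec_def inner_axis intro!: borel_measurable_inner assms)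

lemma measurable_vec_cols_transpose:
  "(\<lambda>N :: real^'d^'nu. vec_cols (transpose N)) \<in> borel_measurable borel"
  unfolding vec_cols_def transpose_def
  by (intro borel_measurable_vec_lambda borel_measurable_continuous_onI) (simp, intro continuous_intros)

lemma measurable_unvec:
  "(\<lambda>v :: real^('nu::finite \<times> 'd::finite). \<chi> i j. v $ (i, j)) \<in> borel_measurable borel"
  by (intro borel_measurable_vec_lambda borel_measurable_continuous_onI) (intro continuous_intros)

lemma has_matrix_normal_law_iff:
  fixes A :: "real^'d^'nu"
  shows "has_matrix_normal_law P N A C \<longleftrightarrow> N \<in> borel_measurable P \<and> distr P borel N = matrix_normal A C"
proof (cases "N \<in> borel_measurable P")
  case True
  let ?u = "\<lambda>v :: real^('nu \<times> 'd). \<chi> i j. v $ (i, j)"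
  let ?v = "\<lambda>N :: real^'d^'nu. vec_cols (transpose N)"
  let ?m = "multivariate_normal (?v A) C"
  have uv: "?u (?v X) = X" for X :: "real^'d^'nu"
    by (simp add: vec_eq_iff vec_cols_transpose_nth)
  have vu: "?v (?u x) = x" for x
    by (auto simp: vec_eq_iff vec_cols_transpose_nth)
  have s: "sets ?m = sets borel"
    by (simp add: multivariate_normal_def)
  have meas: "(\<lambda>\<omega>. ?v (N \<omega>)) \<in> borel_measurable P" "?u \<in> borel_measurable ?m"
    using measurable_compose[OF True measurable_vec_cols_transpose] measurable_unvec
      measurable_cong_sets[OF s refl] by auto
  have "distr P borel (\<lambda>\<omega>. ?v (N \<omega>)) = ?m \<longleftrightarrow> distr P borel N = distr ?m borel ?u"
  proof
    assume *: "distr P borel (\<lambda>\<omega>. ?v (N \<omega>)) = ?m"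
    show "distr P borel N = distr ?m borel ?u"
      unfolding *[symmetric] distr_distr[OF measurable_unvec meas(1)] by (simp add: comp_def uv)
  next
    assume *: "distr P borel N = distr ?m borel ?u"
    have "distr P borel (\<lambda>\<omega>. ?v (N \<omega>)) = distr (distr P borel N) borel ?v"
      by (simp add: distr_distr[OF measurable_vec_cols_transpose True] comp_def)
    also have "\<dots> = distr ?m borel (\<lambda>x. x)"
      unfolding * distr_distr[OF measurable_vec_cols_transpose meas(2)] by (simp add: comp_def vu)
    also have "\<dots> = ?m"
      by (rule distr_id2) (simp add: s)
    finally show "distr P borel (\<lambda>\<omega>. ?v (N \<omega>)) = ?m" .
  qed
  with True show ?thesis
    by (simp add: has_matrix_normal_law_def matrix_normal_def)
qed (simp add: has_matrix_normal_law_def)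

definition std_brownian_motion :: "'w measure \<Rightarrow> (real \<Rightarrow> 'w \<Rightarrow> real) \<Rightarrow> bool" where
  "std_brownian_motion M W \<longleftrightarrow>
     prob_space M \<and>
     (\<forall>t\<ge>0. W t \<in> borel_measurable M) \<and>
     (AE \<omega> in M. W 0 \<omega> = 0) \<and>
     (\<forall>s\<ge>0. \<forall>t>s. distributed M lborel (\<lambda>\<omega>. W t \<omega> - W s \<omega>) (normal_density 0 (sqrt (t - s)))) \<and>
     (\<forall>(\<tau> :: nat \<Rightarrow> real) n. 0 \<le> \<tau> 0 \<and> mono \<tau> \<longrightarrow>
        prob_space.indep_vars M (\<lambda>_. borel) (\<lambda>k \<omega>. W (\<tau> (Suc k)) \<omega> - W (\<tau> k) \<omega>) {..<n}) \<and>
     (AE \<omega> in M. continuous_on {0..} (\<lambda>t. W t \<omega>))"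

text \<open>The entries are independent as processes, that is, as random elements of
  \<open>\<real>\<close> to the power \<open>[0, \<infinity>)\<close>.\<close>

definition matrix_brownian_motion :: "'w measure \<Rightarrow> (real \<Rightarrow> 'w \<Rightarrow> real^'d^'nu) \<Rightarrow> bool" where
  "matrix_brownian_motion M B \<longleftrightarrow>
     (\<forall>i j. std_brownian_motion M (\<lambda>t \<omega>. B t \<omega> $ i $ j)) \<and>
     prob_space.indep_vars M (\<lambda>_. PiM {0..} (\<lambda>_. borel))
       (\<lambda>p \<omega>. \<lambda>t\<in>{0..}. B t \<omega> $ fst p $ snd p) UNIV"

text \<open>\<open>X\<close> solves \<open>dX = - X dt + \<surd>2 \<Psi>\<^sup>1\<^sup>/\<^sup>2 dB \<Sigma>\<^sup>1\<^sup>/\<^sup>2\<close> with \<open>X\<^sub>0 = x\<close>, in integral form.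
  The integrand of the stochastic integral is constant, so that its value over \<open>[0, t]\<close> is the
  integrand applied to \<open>B\<^sub>t - B\<^sub>0\<close>, and no further theory of stochastic integration is involved.
  The equation determines \<open>X\<close> from \<open>B\<close> path by path, hence no separate adaptedness condition.\<close>

definition matrix_OU_solution ::
    "'w measure \<Rightarrow> (real \<Rightarrow> 'w \<Rightarrow> real^'d^'nu) \<Rightarrow> real^'nu^'nu \<Rightarrow> real^'d^'d \<Rightarrow>
     real^'d^'nu \<Rightarrow> (real \<Rightarrow> 'w \<Rightarrow> real^'d^'nu) \<Rightarrow> bool" where
  "matrix_OU_solution M B \<Psi> \<Sigma> x X \<longleftrightarrow>
     (\<forall>t\<ge>0. X t \<in> borel_measurable M) \<and>
     (AE \<omega> in M. X 0 \<omega> = x) \<and>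
     (AE \<omega> in M. continuous_on {0..} (\<lambda>t. X t \<omega>)) \<and>
     (AE \<omega> in M. \<forall>t\<ge>0. X t \<omega> = X 0 \<omega> - integral {0..t} (\<lambda>s. X s \<omega>)
        + sqrt 2 *\<^sub>R (sym_sqrt \<Psi> ** (B t \<omega> - B 0 \<omega>) ** sym_sqrt \<Sigma>))"

text \<open>In the following, \<open>X x\<close> is the process with initial value \<open>x\<close>, so that the law of
  \<open>X x t\<close> is the law at time \<open>t\<close> given the initial value \<open>x\<close>.\<close>

definition transition_kernel ::
    "'w measure \<Rightarrow> ('s::topological_space \<Rightarrow> real \<Rightarrow> 'w \<Rightarrow> 's) \<Rightarrow> real \<Rightarrow> 's \<Rightarrow> 's measure" where
  "transition_kernel M X t x = distr M borel (X x t)"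

definition semigroup_op :: "(real \<Rightarrow> 's \<Rightarrow> 's measure) \<Rightarrow> real \<Rightarrow> ('s \<Rightarrow> real) \<Rightarrow> 's \<Rightarrow> real" where
  "semigroup_op K t h x = (\<integral>y. h y \<partial>K t x)"

definition measure_semigroup ::
    "'s::topological_space measure \<Rightarrow> (real \<Rightarrow> 's \<Rightarrow> 's measure) \<Rightarrow> real \<Rightarrow> 's measure" where
  "measure_semigroup \<mu> K t = measure_of UNIV (sets borel) (\<lambda>A. \<integral>\<^sup>+ x. emeasure (K t x) A \<partial>\<mu>)"

text \<open>Convergence in law; \<open>weak_conv_m\<close> only covers sequences of measures on the real line.\<close>

definition converges_in_law ::
    "('i \<Rightarrow> 's::topological_space measure) \<Rightarrow> 's measure \<Rightarrow> 'i filter \<Rightarrow> bool" where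
  "converges_in_law \<mu> \<mu>' F \<longleftrightarrow>
     (\<forall>f :: 's \<Rightarrow> real. continuous_on UNIV f \<and> bounded (range f) \<longrightarrow>
        ((\<lambda>i. \<integral>y. f y \<partial>\<mu> i) \<longlongrightarrow> (\<integral>y. f y \<partial>\<mu>')) F)"

end

theory Submission
  imports Defs "HOL-Real_Asymp.Real_Asymp"
begin

text \<open>Since \<open>X\<close> solves the equation pathwise, the driving path is
  \<open>N\<^sub>t = X\<^sub>t - X\<^sub>0 + \<integral> X\<close>, and the Riemann sums \<open>\<Sum> exp (t\<^sub>k - t) (N (t\<^sub>k\<^sub>+\<^sub>1) - N (t\<^sub>k))\<close>
  converge to \<open>X\<^sub>t - exp (- t) X\<^sub>0\<close> by telescoping. Undoing \<open>\<Psi>\<^sup>1\<^sup>/\<^sup>2\<close> and \<open>\<Sigma>\<^sup>1\<^sup>/\<^sup>2\<close>, the same sums over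
  the entries of the Brownian matrix converge almost surely; normalised, each of them is exactly
  standard normal, hence so is its limit. The limits are measurable functions of the independent
  entry paths, so \<open>X\<^sub>t\<close> is an affine image of a standard normal matrix, which gives the law, the
  formula for the semigroup and, by dominated convergence, the limit law. Invariance follows from
  detailed balance: the product of the stationary and the transition density is symmetric.\<close>

subsection \<open>Lebesgue measure under linear maps\<close>

text \<open>Three definitions shape the work. \<open>multivariate_normal\<close> is given by a
  density, so affine images of normal laws need the change of variables formula for invertible
  linear maps, and covariances are kept in the factored form \<open>A ** transpose A\<close>, where
  \<open>A\<close> maps the standard case to the given one. \<open>sym_sqrt\<close> is a definite
  description, which yields nothing before existence and uniqueness are known; both come from the
  spectral theorem. The Brownian entries are independent as whole paths; the limits inherit this
  once each is written as \<open>lim\<close> of a measurable function of one path, defined at every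
  sample point.

  Scaling to unit variance makes the passage to the limit concern a sequence with one fixed law, so
  no continuity of the normal law in its variance is involved. The unscaled variances tend to (1 -
  exp (- 2 t)) / 2, and the factor \<open>sqrt 2\<close> of the noise doubles this to 1 - exp (- 2
  t). Detailed balance rests on a^2 + b^2 = 1 for a = exp (- t) and b = sqrt (1 - exp (- 2 t)). At t
  = 0 the kernel is a point mass without density, so that time is treated apart.\<close>

lemma measurable_vec_lambda_PiM [measurable]:
  "(\<lambda>x. \<chi> i. x i) \<in> (\<Pi>\<^sub>M i\<in>UNIV::'n::finite set. (borel :: real measure)) \<rightarrow>\<^sub>M borel"
  by (rule borel_measurable_vec_lambda) simp

text \<open>Both sides give a box the product of its side lengths, and boxes determine Lebesgue
  measure. This opens the way to integrating one coordinate at a time and to comparing normal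
  densities with product measures.\<close>

lemma lborel_vec_eq_distr_PiM:
  "(lborel :: (real^'n) measure) = distr (\<Pi>\<^sub>M i\<in>UNIV. lborel) borel (\<lambda>x. \<chi> i. x i)"
proof (rule lborel_eqI)
  interpret product_sigma_finite "\<lambda>_::'n. lborel :: real measure"
    by (simp add: product_sigma_finite_def sigma_finite_lborel)
  fix l u :: "real^'n"
  assume le: "\<And>b. b \<in> Basis \<Longrightarrow> l \<bullet> b \<le> u \<bullet> b"
  have le': "l $ i \<le> u $ i" for i
    using le[of "axis i 1"] by (simp add: inner_axis axis_in_Basis_iff)
  have "emeasure (distr (\<Pi>\<^sub>M i\<in>UNIV. lborel) borel (\<lambda>x. \<chi> i. x i)) (box l u)
      = emeasure (\<Pi>\<^sub>M i\<in>UNIV::'n set. lborel) (\<Pi>\<^sub>E i\<in>UNIV. {l$i<..<u$i})"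
    by (subst emeasure_distr)
       (auto simp: space_PiM mem_box_cart PiE_iff set_eq_iff intro!: arg_cong2[where f=emeasure])
  also have "\<dots> = (\<Prod>i\<in>UNIV. ennreal (u $ i - l $ i))"
    by (subst emeasure_PiM) (auto intro!: prod.cong simp: le')
  also have "\<dots> = ennreal (\<Prod>i\<in>UNIV. u $ i - l $ i)"
    by (rule prod_ennreal) (simp add: le')
  also have "(\<Prod>i\<in>UNIV. u $ i - l $ i) = (\<Prod>b\<in>Basis. (u - l) \<bullet> b)"
    by (rule prod.reindex_bij_witness[where i="\<lambda>b. THE i. b = axis i 1" and j="\<lambda>i. axis i 1"])
       (auto simp: Basis_vec_def inner_axis axis_eq_axis)
  finally show "emeasure (distr (\<Pi>\<^sub>M i\<in>UNIV. lborel) borel (\<lambda>x. \<chi> i. x i)) (box l u)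
      = (\<Prod>b\<in>Basis. (u - l) \<bullet> b)" .
qed simp

lemma nn_integral_lborel_vec:
  fixes f :: "real^'n \<Rightarrow> ennreal"
  assumes "f \<in> borel_measurable borel"
  shows "(\<integral>\<^sup>+x. f x \<partial>lborel) = (\<integral>\<^sup>+x. f (\<chi> i. x i) \<partial>(\<Pi>\<^sub>M i\<in>UNIV. lborel))"
  by (subst lborel_vec_eq_distr_PiM) (simp add: nn_integral_distr assms)

lemma borel_measurable_linear:
  fixes g :: "'a::euclidean_space \<Rightarrow> 'b::euclidean_space"
  assumes "linear g"
  shows "g \<in> borel_measurable borel"
  using assms by (intro borel_measurable_continuous_onI linear_continuous_on)
    (simp add: linear_conv_bounded_linear)

text \<open>Both the determinant and the substitution rule are multiplicative under composition, so
  elementary maps suffice. Singular maps must be excluded: for them the left side is 0 whatever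
  \<open>f\<close> is. Hence the implication inside \<open>P\<close>.\<close>

lemma nn_integral_lborel_linear:
  fixes g :: "real^'n \<Rightarrow> real^'n" and f :: "real^'n \<Rightarrow> ennreal"
  assumes "linear g" and "det (matrix g) \<noteq> 0" and "f \<in> borel_measurable borel"
  shows "ennreal \<bar>det (matrix g)\<bar> * (\<integral>\<^sup>+x. f (g x) \<partial>lborel) = (\<integral>\<^sup>+x. f x \<partial>lborel)"
proof -
  define P where "P g \<longleftrightarrow> (det (matrix g) \<noteq> 0 \<longrightarrow> (\<forall>f\<in>borel_measurable borel.
    ennreal \<bar>det (matrix g)\<bar> * (\<integral>\<^sup>+x. f (g x) \<partial>lborel) = (\<integral>\<^sup>+x. f x \<partial>lborel)))" for g :: "real^'n \<Rightarrow> real^'n"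
  have "P g"
  proof (rule induct_linear_elementary[OF \<open>linear g\<close>])
    fix g h :: "real^'n \<Rightarrow> real^'n"
    assume gh: "linear g" "linear h" "P g" "P h"
    note [measurable] = borel_measurable_linear[OF gh(1)] borel_measurable_linear[OF gh(2)]
    have d: "det (matrix (g \<circ> h)) = det (matrix g) * det (matrix h)"
      using gh by (simp add: matrix_compose det_mul)
    show "P (g \<circ> h)"
      unfolding P_def
    proof (intro impI ballI)
      fix f :: "real^'n \<Rightarrow> ennreal"
      assume nz: "det (matrix (g \<circ> h)) \<noteq> 0" and f[measurable]: "f \<in> borel_measurable borel"
      have "ennreal \<bar>det (matrix (g \<circ> h))\<bar> * (\<integral>\<^sup>+x. f ((g \<circ> h) x) \<partial>lborel)
          = ennreal \<bar>det (matrix g)\<bar> * (ennreal \<bar>det (matrix h)\<bar> * (\<integral>\<^sup>+x. f (g (h x)) \<partial>lborel))"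
        by (simp add: d abs_mult ennreal_mult mult.assoc)
      also have "ennreal \<bar>det (matrix h)\<bar> * (\<integral>\<^sup>+x. f (g (h x)) \<partial>lborel) = (\<integral>\<^sup>+x. f (g x) \<partial>lborel)"
        using gh(4) nz d unfolding P_def by (auto elim!: ballE[of _ _ "\<lambda>x. f (g x)"])
      also have "ennreal \<bar>det (matrix g)\<bar> * \<dots> = (\<integral>\<^sup>+x. f x \<partial>lborel)"
        using gh(3) nz d unfolding P_def by auto
      finally show "ennreal \<bar>det (matrix (g \<circ> h))\<bar> * (\<integral>\<^sup>+x. f ((g \<circ> h) x) \<partial>lborel) = (\<integral>\<^sup>+x. f x \<partial>lborel)" .
    qed
  next
    fix g :: "real^'n \<Rightarrow> real^'n" and i
    assume "linear g" and 0: "\<And>x. g x $ i = 0"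
    \<comment> \<open>A map with a vanishing coordinate is not onto, hence not injective, hence of
      determinant 0, so \<open>P g\<close> holds vacuously.\<close>
    then have "\<not> inj g"
      by (metis (full_types) linear_injective_imp_surjective one_neq_zero surjE vec_component)
    then show "P g"
      using det_nz_iff_inj[OF \<open>linear g\<close>] by (simp add: P_def)
  next
    fix c :: "'n \<Rightarrow> real"
    let ?g = "\<lambda>x::real^'n. \<chi> i. c i * x $ i"
    have d: "det (matrix ?g) = prod c UNIV"
      by (simp add: axis_def matrix_def det_diagonal)
    show "P ?g"
      unfolding P_def
    proof (intro impI ballI)
      fix f :: "real^'n \<Rightarrow> ennreal"
      assume nz: "det (matrix ?g) \<noteq> 0" and f[measurable]: "f \<in> borel_measurable borel"
      \<comment> \<open>The affine formula for \<open>lborel\<close> wants its coefficients indexed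
        by basis vectors; \<open>c'\<close> carries the diagonal entries over to them.\<close>
      define c' where "c' b = c (THE i. b = axis i 1)" for b :: "real^'n"
      have c': "c' (axis i 1) = c i" for i
        by (simp add: c'_def axis_eq_axis)
      have B: "(Basis :: (real^'n) set) = (\<lambda>i. axis i 1) ` UNIV"
        by (auto simp: Basis_vec_def)
      have ax: "axis i (1::real) $ k = (if k = i then 1 else 0)" for i k :: 'n
        by (simp add: axis_def)
      have inj: "inj (\<lambda>i::'n. axis i (1::real))"
        by (auto simp: inj_on_def axis_eq_axis)
      have g: "0 + (\<Sum>j\<in>Basis. (c' j * (x \<bullet> j)) *\<^sub>R j) = ?g x" for x :: "real^'n"
        unfolding B by (subst sum.reindex[OF inj]) (simp add: vec_eq_iff c' inner_axis ax if_distrib cong: if_cong)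
      have prod: "(\<Prod>j\<in>Basis. \<bar>c' j\<bar>) = \<bar>prod c UNIV\<bar>"
        unfolding B by (subst prod.reindex[OF inj]) (simp add: c' abs_prod)
      have "lborel = density (distr lborel borel (\<lambda>x. 0 + (\<Sum>j\<in>Basis. (c' j * (x \<bullet> j)) *\<^sub>R j))) (\<lambda>_. ennreal (\<Prod>j\<in>Basis. \<bar>c' j\<bar>))"
        by (rule lborel_affine_euclidean) (use nz d in \<open>auto simp: B c'\<close>)
      then have *: "lborel = density (distr lborel borel ?g) (\<lambda>_. ennreal \<bar>prod c UNIV\<bar>)"
        unfolding g prod .
      have [measurable]: "?g \<in> borel_measurable borel"
        by (intro borel_measurable_vec_lambda) simp
      show "ennreal \<bar>det (matrix ?g)\<bar> * (\<integral>\<^sup>+x. f (?g x) \<partial>lborel) = (\<integral>\<^sup>+x. f x \<partial>lborel)"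
        by (subst (2) *) (simp add: nn_integral_density nn_integral_distr nn_integral_cmult d)
    qed
  next
    fix m n :: 'n
    assume mn: "m \<noteq> n"
    let ?g = "\<lambda>x::real^'n. \<chi> i. x $ Transposition.transpose m n i"
    have "(\<chi> i j. if Transposition.transpose m n i = j then 1 else 0) = (\<chi> i j. if j = Transposition.transpose m n i then 1 else (0::real))"
      by (auto intro!: Cart_lambda_cong)
    then have "matrix ?g = transpose (\<chi> i j. mat 1 $ i $ Transposition.transpose m n j)"
      by (auto simp: matrix_eq transpose_def axis_def mat_def matrix_def)
    then have d: "\<bar>det (matrix ?g)\<bar> = 1"
      by (simp add: det_permute_columns permutes_swap_id sign_swap_id abs_mult)
    have [measurable]: "?g \<in> borel_measurable borel"
      by (intro borel_measurable_vec_lambda) simp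
    \<comment> \<open>The preimage of a box under a coordinate swap is the box with swapped corners,
      and its volume is the same product in another order.\<close>
    have lb: "lborel = distr lborel borel ?g"
    proof (rule lborel_eqI)
      fix l u :: "real^'n"
      assume le: "\<And>b. b \<in> Basis \<Longrightarrow> l \<bullet> b \<le> u \<bullet> b"
      have le': "l $ i \<le> u $ i" for i
        using le[of "axis i 1"] by (simp add: inner_axis axis_in_Basis_iff)
      have "?g -` box l u = box (?g l) (?g u)"
        by (auto simp: mem_box_cart) (metis transpose_involutory)+
      then have "emeasure (distr lborel borel ?g) (box l u) = emeasure lborel (box (?g l) (?g u))"
        by (simp add: emeasure_distr)
      also have "\<dots> = (\<Prod>b\<in>Basis. (?g u - ?g l) \<bullet> b)"
        by (rule emeasure_lborel_box) (auto simp: Basis_vec_def inner_axis le')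
      also have "(\<Prod>b\<in>Basis. (?g u - ?g l) \<bullet> b) = (\<Prod>i\<in>UNIV. (u - l) $ Transposition.transpose m n i)"
        by (rule sym, rule prod.reindex_bij_witness[where i="\<lambda>b. THE i. b = axis i 1" and j="\<lambda>i. axis i 1"])
           (auto simp: Basis_vec_def inner_axis axis_eq_axis)
      also have "\<dots> = (\<Prod>i\<in>UNIV. (u - l) $ i)"
        by (rule prod.reindex_bij_witness[where i="Transposition.transpose m n" and j="Transposition.transpose m n"]) auto
      also have "\<dots> = (\<Prod>b\<in>Basis. (u - l) \<bullet> b)"
        by (rule prod.reindex_bij_witness[where i="\<lambda>b. THE i. b = axis i 1" and j="\<lambda>i. axis i 1"])
           (auto simp: Basis_vec_def inner_axis axis_eq_axis)
      finally show "emeasure (distr lborel borel ?g) (box l u) = (\<Prod>b\<in>Basis. (u - l) \<bullet> b)" .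
    qed simp
    show "P ?g"
      unfolding P_def d
      by (intro impI ballI, subst (2) lb) (simp add: nn_integral_distr)
  next
    fix m n :: 'n
    assume mn: "m \<noteq> n"
    let ?g = "\<lambda>x::real^'n. \<chi> i. if i = m then x $ m + x $ n else x $ i"
    have "matrix ?g = (\<chi> k. if k = m then row m (mat 1) + 1 *s row n (mat 1) else row k (mat 1))"
      using mn by (auto simp: matrix_def row_def vec_eq_iff axis_def mat_def)
    then have d: "det (matrix ?g) = 1"
      by (simp only: det_row_operation[OF mn] det_I)
    interpret product_sigma_finite "\<lambda>_::'n. lborel :: real measure"
      by (simp add: product_sigma_finite_def sigma_finite_lborel)
    have [measurable]: "?g \<in> borel_measurable borel"
      by (intro borel_measurable_vec_lambda) simp
    have "(\<integral>\<^sup>+x. f (?g x) \<partial>lborel) = (\<integral>\<^sup>+x. f x \<partial>lborel)"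
      if f[measurable]: "f \<in> borel_measurable borel" for f :: "real^'n \<Rightarrow> ennreal"
    proof -
      \<comment> \<open>With all coordinates but the \<open>m\<close>-th fixed, the shear is a
        translation by \<open>x n\<close> on the line, so integrating over the \<open>m\<close>-th
        coordinate first removes it.\<close>
      let ?I = "UNIV - {m}"
      have I: "finite ?I" "m \<notin> ?I" "insert m ?I = UNIV"
        by auto
      have split: "(\<integral>\<^sup>+x. h x \<partial>lborel)
          = (\<integral>\<^sup>+ x. (\<integral>\<^sup>+ y. h (\<chi> i. (x(m := y)) i) \<partial>lborel) \<partial>(\<Pi>\<^sub>M i\<in>?I. lborel))"
        if [measurable]: "h \<in> borel_measurable borel" for h :: "real^'n \<Rightarrow> ennreal"
        using product_nn_integral_insert[of ?I m "\<lambda>x. h (\<chi> i. x i)"]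
        by (simp add: nn_integral_lborel_vec I(3))
      have "(\<integral>\<^sup>+ y. f (?g (\<chi> i. (x(m := y)) i)) \<partial>lborel)
          = (\<integral>\<^sup>+ y. f (\<chi> i. (x(m := y)) i) \<partial>lborel)" for x :: "'n \<Rightarrow> real"
      proof -
        have eq: "?g (\<chi> i. (x(m := y)) i) = (\<chi> i. (x(m := x n + 1 * y)) i)" for y
          using mn by (auto simp: vec_eq_iff)
        have meas: "(\<lambda>y. f (\<chi> i. (x(m := y)) i)) \<in> borel_measurable borel"
          by (intro measurable_compose[OF _ f] borel_measurable_vec_lambda) (auto simp: fun_upd_def)
        show ?thesis
          unfolding eq
          using nn_integral_real_affine[of "\<lambda>y. f (\<chi> i. (x(m := y)) i)" 1 "x n", OF meas]
          by (simp add: fun_upd_def)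
      qed
      then show ?thesis
        by (simp only: split[OF f] split[OF measurable_compose[OF \<open>?g \<in> _\<close> f]])
    qed
    then show "P ?g"
      by (simp add: P_def d)
  qed
  then show ?thesis
    using assms by (simp add: P_def)
qed

subsection \<open>Square roots of positive semidefinite matrices\<close>

lemma transpose_eq_self_iff:
  fixes S :: "real^'n^'n"
  shows "transpose S = S \<longleftrightarrow> (\<forall>x y. (S *v x) \<bullet> y = x \<bullet> (S *v y))"
proof
  assume "transpose S = S"
  then show "\<forall>x y. (S *v x) \<bullet> y = x \<bullet> (S *v y)"
    by (metis dot_lmul_matrix transpose_matrix_vector)
next
  assume *: "\<forall>x y. (S *v x) \<bullet> y = x \<bullet> (S *v y)"
  have "transpose S *v x = S *v x" for x
    by (metis * dot_lmul_matrix transpose_matrix_vector vector_eq_rdot)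
  then show "transpose S = S"
    by (simp add: matrix_eq)
qed

text \<open>The form \<open>x \<bullet> f x\<close> is minimal on \<open>V\<close> where it
  vanishes. Moving from \<open>x\<close> by a small step along \<open>- f x\<close> changes it by
  e^2 c - 2 e |f x|^2, which would be negative for small e unless \<open>f x = 0\<close>.\<close>

lemma semidefinite_kernel:
  fixes f :: "'a::euclidean_space \<Rightarrow> 'a"
  assumes f: "linear f" and self: "\<And>x y. f x \<bullet> y = x \<bullet> f y"
    and V: "subspace V" "f ` V \<subseteq> V" and pos: "\<And>x. x \<in> V \<Longrightarrow> 0 \<le> x \<bullet> f x"
    and x: "x \<in> V" "x \<bullet> f x = 0"
  shows "f x = 0"
proof -
  define c where "c = f x \<bullet> f (f x)"
  \<comment> \<open>Small enough that e * c \<le> |f x|^2, so the quadratic term costs at most half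
    of the linear gain; the 1 in the denominator keeps it positive when
    \<open>c = 0\<close>.\<close>
  define e where "e = (f x \<bullet> f x) / (c + 1)"
  have fx: "f x \<in> V"
    using V x by blast
  have c: "c \<ge> 0"
    unfolding c_def by (rule pos[OF fx])
  have "0 \<le> (x - e *\<^sub>R f x) \<bullet> f (x - e *\<^sub>R f x)"
    by (intro pos subspace_diff V subspace_scale x fx)
  also have "\<dots> = e * (e * c) - 2 * e * (f x \<bullet> f x)"
  proof -
    have "x \<bullet> f (f x) = f x \<bullet> f x"
      by (simp add: self)
    then show ?thesis
      using x by (simp add: linear_diff[OF f] linear_scale[OF f] inner_diff c_def algebra_simps)
  qed
  finally have "2 * (e * (f x \<bullet> f x)) \<le> e * (e * c)"
    by simp
  also have "\<dots> \<le> e * (f x \<bullet> f x)"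
    using c by (intro mult_left_mono) (simp_all add: e_def field_simps mult_left_le)
  finally have "(f x \<bullet> f x) * (f x \<bullet> f x) / (c + 1) \<le> 0"
    by (simp add: e_def)
  with c have "(f x \<bullet> f x) * (f x \<bullet> f x) \<le> 0"
    by (simp add: divide_le_0_iff)
  then show ?thesis
    by (metis inner_eq_zero_iff inner_ge_zero mult_le_0_iff order_antisym)
qed

text \<open>A unit vector of \<open>V\<close> maximising the Rayleigh quotient is an eigenvector.\<close>

lemma self_adjoint_eigenvector:
  fixes f :: "'a::euclidean_space \<Rightarrow> 'a"
  assumes f: "linear f" and self: "\<And>x y. f x \<bullet> y = x \<bullet> f y"
    and V: "subspace V" "f ` V \<subseteq> V" and "V \<noteq> {0}"
  obtains v where "v \<in> V" "norm v = 1" "f v = (v \<bullet> f v) *\<^sub>R v"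
proof -
  have "compact (V \<inter> sphere 0 1)"
    by (intro closed_Int_compact closed_subspace V compact_sphere)
  moreover obtain z where z: "z \<in> V" "z \<noteq> 0"
    using \<open>V \<noteq> {0}\<close> subspace_0[OF V(1)] by auto
  then have "(1 / norm z) *\<^sub>R z \<in> V \<inter> sphere 0 1"
    by (auto intro: subspace_scale V)
  then have "V \<inter> sphere 0 1 \<noteq> {}"
    by blast
  moreover have "continuous_on (V \<inter> sphere 0 1) (\<lambda>x. x \<bullet> f x)"
    by (intro continuous_intros linear_continuous_on) (use f in \<open>simp add: linear_conv_bounded_linear\<close>)
  ultimately obtain v where "v \<in> V \<inter> sphere 0 1" "\<forall>x\<in>V \<inter> sphere 0 1. x \<bullet> f x \<le> v \<bullet> f v"
    using continuous_attains_sup[of "V \<inter> sphere 0 1" "\<lambda>x. x \<bullet> f x"] by blast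
  then have v: "v \<in> V" "norm v = 1"
    and max: "\<And>x. x \<in> V \<Longrightarrow> norm x = 1 \<Longrightarrow> x \<bullet> f x \<le> v \<bullet> f v"
    by auto
  define l where "l = v \<bullet> f v"
  \<comment> \<open>Maximality of \<open>l\<close> makes \<open>l - f\<close> positive semidefinite
    on \<open>V\<close>, with its form vanishing at \<open>v\<close>; so \<open>v\<close> lies in
    its kernel.\<close>
  have "l *\<^sub>R v - f v = 0"
  proof (rule semidefinite_kernel[of "\<lambda>x. l *\<^sub>R x - f x" V])
    show "linear (\<lambda>x. l *\<^sub>R x - f x)"
      by (intro linear_compose_sub linear_compose_scale_right f linear_ident)
    show "(l *\<^sub>R x - f x) \<bullet> y = x \<bullet> (l *\<^sub>R y - f y)" for x y
      by (simp add: inner_diff self)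
    show "(\<lambda>x. l *\<^sub>R x - f x) ` V \<subseteq> V"
      using V by (auto intro!: subspace_diff subspace_scale)
    show "v \<bullet> (l *\<^sub>R v - f v) = 0"
      using v by (simp add: inner_diff l_def norm_eq_1)
    fix x assume x: "x \<in> V"
    show "0 \<le> x \<bullet> (l *\<^sub>R x - f x)"
    proof (cases "x = 0")
      case False
      have "((1 / norm x) *\<^sub>R x) \<bullet> f ((1 / norm x) *\<^sub>R x) \<le> l"
        unfolding l_def using False x by (intro max subspace_scale V) auto
      then have "(x \<bullet> f x) / (norm x)\<^sup>2 \<le> l"
        by (simp add: linear_scale[OF f] power2_eq_square)
      then show ?thesis
        using False by (simp add: inner_diff field_simps power2_norm_eq_inner)
    qed simp
  qed (use V v in auto)
  then show thesis
    using v by (intro that[of v]) (auto simp: l_def)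
qed

text \<open>A maximal orthonormal set of eigenvectors spans, since its orthogonal complement is invariant.\<close>

theorem self_adjoint_orthonormal_eigenbasis:
  fixes f :: "'a::euclidean_space \<Rightarrow> 'a"
  assumes f: "linear f" and self: "\<And>x y. f x \<bullet> y = x \<bullet> f y"
  shows "\<exists>B. finite B \<and> pairwise orthogonal B \<and>
    (\<forall>b\<in>B. norm b = 1 \<and> f b = (b \<bullet> f b) *\<^sub>R b) \<and> (\<forall>x. (\<Sum>b\<in>B. (x \<bullet> b) *\<^sub>R b) = x)"
proof -
  define Q where "Q B \<longleftrightarrow> pairwise orthogonal B \<and> (\<forall>b\<in>B. norm b = 1 \<and> f b = (b \<bullet> f b) *\<^sub>R b)" for B
  have fin: "finite B" "card B \<le> DIM('a)" if "Q B" for B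
  proof -
    have "independent B"
      using that by (intro pairwise_orthogonal_independent) (auto simp: Q_def)
    then show "finite B" "card B \<le> DIM('a)"
      using independent_bound by blast+
  qed
  have "Q {}"
    by (simp add: Q_def)
  \<comment> \<open>Maximal means of greatest cardinality, which exists because orthonormal sets are
    independent and so bounded in size by the dimension.\<close>
  then obtain B where B: "Q B" and max: "\<And>C. Q C \<Longrightarrow> card C \<le> card B"
    using ex_has_greatest_nat[of Q "{}" card "Suc DIM('a)"] fin(2) by (auto simp: le_imp_less_Suc)
  define V where "V = {y. \<forall>b\<in>B. orthogonal b y}"
  have V: "subspace V"
    unfolding V_def by (rule subspace_orthogonal_to_vectors)
  have inv: "f ` V \<subseteq> V"
  proof (clarsimp simp: V_def)
    fix y b assume y: "\<forall>b\<in>B. orthogonal b y" and b: "b \<in> B"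
    have "f b \<bullet> y = ((b \<bullet> f b) *\<^sub>R b) \<bullet> y"
      using B b by (auto simp: Q_def)
    then show "orthogonal b (f y)"
      using y b by (simp add: orthogonal_def self[symmetric])
  qed
  have "V = {0}"
  proof (rule ccontr)
    assume "V \<noteq> {0}"
    then obtain v where v: "v \<in> V" "norm v = 1" "f v = (v \<bullet> f v) *\<^sub>R v"
      by (rule self_adjoint_eigenvector[OF f self V inv]) blast
    have "v \<notin> B"
      using v by (auto simp: V_def orthogonal_def norm_eq_1)
    have "Q (insert v B)"
      using B v by (auto simp: Q_def V_def pairwise_insert orthogonal_commute)
    from max[OF this] show False
      using \<open>v \<notin> B\<close> fin(1)[OF B] by simp
  qed
  have ortho: "b \<bullet> c = (if b = c then 1 else 0)" if "b \<in> B" "c \<in> B" for b c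
    using B that by (auto simp: Q_def pairwise_def orthogonal_def norm_eq_1)
  have "(\<Sum>b\<in>B. (x \<bullet> b) *\<^sub>R b) = x" for x
  proof -
    have "x - (\<Sum>b\<in>B. (x \<bullet> b) *\<^sub>R b) \<in> V"
      using fin(1)[OF B]
      by (auto simp: V_def orthogonal_def inner_diff inner_sum_right ortho inner_commute[of x] if_distrib cong: if_cong)
    with \<open>V = {0}\<close> show ?thesis
      by simp
  qed
  with B fin(1)[OF B] show ?thesis
    unfolding Q_def by blast
qed

lemma sym_possemidef_sqrt_exists:
  assumes "sym_possemidef S"
  shows "\<exists>R. sym_possemidef R \<and> R ** R = S"
proof -
  let ?f = "(*v) S"
  have self: "?f x \<bullet> y = x \<bullet> ?f y" for x y
    using assms by (simp add: sym_possemidef_def transpose_eq_self_iff)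
  obtain B where B: "finite B" "pairwise orthogonal B" "\<And>b. b \<in> B \<Longrightarrow> norm b = 1"
    and eig: "\<And>b. b \<in> B \<Longrightarrow> ?f b = (b \<bullet> ?f b) *\<^sub>R b" and ex: "\<And>x. (\<Sum>b\<in>B. (x \<bullet> b) *\<^sub>R b) = x"
    using self_adjoint_orthonormal_eigenbasis[OF matrix_vector_mul_linear self] by blast
  \<comment> \<open>For a unit eigenvector \<open>b\<close>, \<open>b \<bullet> ?f b\<close> is its
    eigenvalue. The root keeps the eigenbasis and takes square roots of the eigenvalues.\<close>
  define s where "s b = sqrt (b \<bullet> ?f b)" for b
  have s: "s b \<ge> 0" "s b * s b = b \<bullet> ?f b" for b
    using assms by (auto simp: s_def sym_possemidef_def)
  define r where "r x = (\<Sum>b\<in>B. (s b * (x \<bullet> b)) *\<^sub>R b)" for x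
  have r: "linear r"
    by (rule linearI) (simp_all add: r_def inner_simps sum.distrib algebra_simps scaleR_sum_right)
  have mr: "matrix r *v x = r x" for x
    by (rule matrix_works) (simp add: r linear_matrix_vector_mul_eq)
  have ortho: "b \<bullet> c = (if b = c then 1 else 0)" if "b \<in> B" "c \<in> B" for b c
    using B that by (auto simp: pairwise_def orthogonal_def norm_eq_1)
  have rb: "r b = s b *\<^sub>R b" if "b \<in> B" for b
  proof -
    have "r b = (\<Sum>c\<in>B. if b = c then s c *\<^sub>R c else 0)"
      unfolding r_def using that by (intro sum.cong) (auto simp: ortho)
    then show ?thesis
      using that B(1) by simp
  qed
  have "r (r x) = ?f x" for x
  proof -
    have "r (r x) = (\<Sum>b\<in>B. (x \<bullet> b) *\<^sub>R ?f b)"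
      unfolding r_def[of x] linear_sum[OF r] linear_scale[OF r]
    proof (rule sum.cong[OF refl])
      fix b assume b: "b \<in> B"
      show "(s b * (x \<bullet> b)) *\<^sub>R r b = (x \<bullet> b) *\<^sub>R ?f b"
        unfolding rb[OF b] by (subst eig[OF b]) (simp add: s(2)[symmetric])
    qed
    also have "\<dots> = ?f (\<Sum>b\<in>B. (x \<bullet> b) *\<^sub>R b)"
      by (simp add: linear_sum[OF matrix_vector_mul_linear] matrix_vector_mult_scaleR)
    finally show ?thesis
      by (simp add: ex)
  qed
  then have "matrix r ** matrix r = S"
    by (simp add: matrix_eq mr flip: matrix_vector_mul_assoc)
  moreover have "transpose (matrix r) = matrix r"
    unfolding transpose_eq_self_iff mr r_def
    by (simp add: inner_sum_left inner_sum_right inner_commute[of b y for b y] mult_ac)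
  moreover have "x \<bullet> r x \<ge> 0" for x
    unfolding r_def inner_sum_right
    by (intro sum_nonneg) (simp add: s(1) mult.assoc)
  ultimately show ?thesis
    by (auto simp: sym_possemidef_def mr)
qed

text \<open>Only \<open>R\<close> is diagonalised. On an eigenvector \<open>b\<close> of
  \<open>R\<close> with eigenvalue m, (P + m)(P - m) b = P^2 b - m^2 b = 0, so
  \<open>w = P b - m b\<close> satisfies \<open>P w = - m w\<close>. For m > 0 semidefiniteness of
  \<open>P\<close> forbids a negative eigenvalue and \<open>w = 0\<close>; for m = 0, |P b|^2 = b
  \<bullet> P^2 b = 0. Hence \<open>P\<close> and \<open>R\<close> agree on a spanning set.\<close>

lemma sym_possemidef_sqrt_unique:
  assumes P: "sym_possemidef P" and R: "sym_possemidef R" and eq: "P ** P = R ** R"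
  shows "P = R"
proof -
  have Rself: "(R *v x) \<bullet> y = x \<bullet> (R *v y)" and Pself: "(P *v x) \<bullet> y = x \<bullet> (P *v y)" for x y
    using R P by (simp_all add: sym_possemidef_def transpose_eq_self_iff)
  obtain B where eig: "\<And>b. b \<in> B \<Longrightarrow> R *v b = (b \<bullet> (R *v b)) *\<^sub>R b"
    and ex: "\<And>x. (\<Sum>b\<in>B. (x \<bullet> b) *\<^sub>R b) = x"
    using self_adjoint_orthonormal_eigenbasis[OF matrix_vector_mul_linear Rself] by blast
  have "P *v b = R *v b" if "b \<in> B" for b
  proof -
    define m where "m = b \<bullet> (R *v b)"
    define w where "w = P *v b - m *\<^sub>R b"
    have m: "m \<ge> 0" and Rb: "R *v b = m *\<^sub>R b"
      using R eig[OF that] by (auto simp: m_def sym_possemidef_def)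
    have PP: "P *v (P *v b) = (m * m) *\<^sub>R b"
      by (simp add: matrix_vector_mul_assoc eq) (simp add: Rb matrix_vector_mult_scaleR flip: matrix_vector_mul_assoc)
    then have Pw: "P *v w = - m *\<^sub>R w"
      by (simp add: w_def matrix_vector_mult_diff_distrib matrix_vector_mult_scaleR algebra_simps)
    have "w = 0"
    proof (cases "m = 0")
      case True
      then have "(P *v b) \<bullet> (P *v b) = 0"
        using PP by (simp add: Pself)
      with True show ?thesis
        by (simp add: w_def)
    next
      case False
      have "0 \<le> w \<bullet> (P *v w)"
        using P by (simp add: sym_possemidef_def)
      then have "m * (w \<bullet> w) \<le> 0"
        by (simp add: Pw)
      with False m have "w \<bullet> w \<le> 0"
        by (simp add: mult_le_0_iff)
      then show ?thesis
        by (metis inner_eq_zero_iff inner_ge_zero order_antisym)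
    qed
    then show ?thesis
      by (simp add: w_def Rb)
  qed
  then have "P *v (\<Sum>b\<in>B. (x \<bullet> b) *\<^sub>R b) = R *v (\<Sum>b\<in>B. (x \<bullet> b) *\<^sub>R b)" for x
    by (simp add: linear_sum[OF matrix_vector_mul_linear] matrix_vector_mult_scaleR)
  then show ?thesis
    by (simp add: matrix_eq ex)
qed

text \<open>Existence and uniqueness together discharge the \<open>THE\<close> in
  \<open>sym_sqrt\<close>.\<close>

lemma
  assumes "sym_possemidef S"
  shows sym_possemidef_sym_sqrt: "sym_possemidef (sym_sqrt S)"
    and sym_sqrt_mult_self: "sym_sqrt S ** sym_sqrt S = S"
proof -
  have "sym_possemidef (sym_sqrt S) \<and> sym_sqrt S ** sym_sqrt S = S"
    unfolding sym_sqrt_def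
    by (rule theI', rule ex_ex1I[OF sym_possemidef_sqrt_exists[OF assms]])
       (auto intro: sym_possemidef_sqrt_unique)
  then show "sym_possemidef (sym_sqrt S)" "sym_sqrt S ** sym_sqrt S = S"
    by auto
qed

lemma sym_posdef_imp_sym_possemidef: "sym_posdef S \<Longrightarrow> sym_possemidef S"
  unfolding sym_posdef_def sym_possemidef_def
  by (metis inner_zero_left order_less_imp_le order_refl)

lemma invertible_sym_sqrt:
  assumes "sym_posdef S"
  shows "invertible (sym_sqrt S)"
proof -
  have "x = 0" if "sym_sqrt S *v x = 0" for x
  proof -
    have "S *v x = sym_sqrt S *v (sym_sqrt S *v x)"
      by (simp add: matrix_vector_mul_assoc sym_sqrt_mult_self[OF sym_posdef_imp_sym_possemidef[OF assms]])
    with that show ?thesis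
      using assms by (auto simp: sym_posdef_def)
  qed
  then show ?thesis
    by (simp add: invertible_left_inverse matrix_left_invertible_ker)
qed

subsection \<open>Kronecker products and normal laws\<close>

lemma kron_mult: "kron A B ** kron C D = kron (A ** C) (B ** D)"
proof -
  have "(\<Sum>q\<in>UNIV. A $ i $ fst q * B $ j $ snd q * (C $ fst q $ k * D $ snd q $ l))
      = (\<Sum>p\<in>UNIV. A $ i $ p * C $ p $ k) * (\<Sum>q\<in>UNIV. B $ j $ q * D $ q $ l)" for i j k l
    unfolding UNIV_Times_UNIV[symmetric]
    by (simp add: sum.cartesian_product' sum_product mult_ac split_beta del: UNIV_Times_UNIV)
  then show ?thesis
    by (simp add: kron_def matrix_matrix_mult_def vec_eq_iff)
qed

lemma transpose_kron: "transpose (kron A B) = kron (transpose A) (transpose B)"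
  by (simp add: kron_def transpose_def vec_eq_iff)

lemma kron_mat_1: "kron (mat 1) (mat 1) = mat 1"
  by (auto simp: kron_def mat_def vec_eq_iff prod_eq_iff)

lemma invertible_kron:
  assumes "invertible A" "invertible B"
  shows "invertible (kron A B)"
proof -
  obtain A' B' where "A ** A' = mat 1" "A' ** A = mat 1" "B ** B' = mat 1" "B' ** B = mat 1"
    using assms by (auto simp: invertible_def)
  then have "kron A B ** kron A' B' = mat 1" "kron A' B' ** kron A B = mat 1"
    by (simp_all add: kron_mult kron_mat_1)
  then show ?thesis
    unfolding invertible_def by blast
qed

text \<open>This is where the Kronecker product comes from: stacking rows turns the two-sided
  product into a single matrix acting on a vector, so vector normal laws apply.\<close>

lemma vec_cols_transpose_mult:
  "vec_cols (transpose (A ** Z ** B)) = kron A (transpose B) *v vec_cols (transpose Z)"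
proof -
  have "(\<Sum>l\<in>UNIV. (\<Sum>k\<in>UNIV. A $ i $ k * Z $ k $ l) * B $ l $ j)
      = (\<Sum>q\<in>UNIV. A $ i $ fst q * B $ snd q $ j * Z $ fst q $ snd q)" for i j
  proof -
    have "(\<Sum>l\<in>UNIV. (\<Sum>k\<in>UNIV. A $ i $ k * Z $ k $ l) * B $ l $ j)
        = (\<Sum>k\<in>UNIV. \<Sum>l\<in>UNIV. A $ i $ k * B $ l $ j * Z $ k $ l)"
      unfolding sum_distrib_right by (subst sum.swap) (simp add: mult_ac)
    then show ?thesis
      unfolding UNIV_Times_UNIV[symmetric]
      by (simp add: sum.cartesian_product' split_beta del: UNIV_Times_UNIV)
  qed
  then show ?thesis
    by (simp add: kron_def matrix_matrix_mult_def matrix_vector_mult_def vec_cols_def transpose_def vec_eq_iff)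
qed

lemma matrix_inv_unique:
  fixes A :: "real^'n^'n"
  assumes "A ** B = mat 1"
  shows "matrix_inv A = B"
proof -
  have BA: "B ** A = mat 1"
    using assms by (simp add: matrix_left_right_inverse)
  then have "A ** matrix_inv A = mat 1 \<and> matrix_inv A ** A = mat 1"
    unfolding matrix_inv_def
    using assms by (metis (mono_tags, lifting) someI_ex)
  then have "matrix_inv A ** (A ** B) = B"
    by (simp add: matrix_mul_assoc)
  then show ?thesis
    by (simp add: assms)
qed

text \<open>The inverse of \<open>A ** transpose A\<close> is the product of the inverse transpose
  and the inverse of \<open>A\<close>; in the coordinates \<open>z\<close> the covariance form
  becomes the squared length.\<close>

lemma inner_matrix_inv_mult_transpose:
  fixes A :: "real^'n^'n"
  assumes "invertible A"
  shows "(A *v z) \<bullet> (matrix_inv (A ** transpose A) *v (A *v z)) = z \<bullet> z"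
proof -
  obtain A' where A': "A ** A' = mat 1" "A' ** A = mat 1"
    using assms by (auto simp: invertible_def)
  have t: "transpose A ** transpose A' = mat 1"
    unfolding matrix_transpose_mul[symmetric] A' transpose_mat ..
  have "(A ** transpose A) ** (transpose A' ** A') = A ** (transpose A ** transpose A') ** A'"
    by (simp only: matrix_mul_assoc)
  then have "(A ** transpose A) ** (transpose A' ** A') = mat 1"
    by (simp only: t A' matrix_mul_rid)
  then have "matrix_inv (A ** transpose A) *v (A *v z) = (transpose A' ** A') *v (A *v z)"
    by (simp only: matrix_inv_unique)
  also have "\<dots> = transpose A' *v ((A' ** A) *v z)"
    by (simp only: matrix_vector_mul_assoc matrix_mul_assoc)
  also have "\<dots> = transpose A' *v z"
    by (simp only: A' matrix_vector_mul_lid)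
  finally have "(A *v z) \<bullet> (matrix_inv (A ** transpose A) *v (A *v z)) = ((A *v z) v* transpose A') \<bullet> z"
    by (simp only: dot_lmul_matrix)
  also have "(A *v z) v* transpose A' = transpose (transpose A') *v (A *v z)"
    by (simp only: transpose_matrix_vector)
  also have "\<dots> = z"
    by (simp only: transpose_transpose matrix_vector_mul_assoc A' matrix_vector_mul_lid)
  finally show ?thesis .
qed

section \<open>Gaussian densities under affine maps\<close>

definition normal_dens :: "real^'k \<Rightarrow> real^'k^'k \<Rightarrow> real^'k \<Rightarrow> real" where
  "normal_dens m C x =
     exp (- ((x - m) \<bullet> (matrix_inv C *v (x - m))) / 2) / sqrt ((2 * pi) ^ CARD('k) * det C)"

lemma multivariate_normal_eq_density: "multivariate_normal m C = density lborel (normal_dens m C)"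
  by (simp add: multivariate_normal_def normal_dens_def)

lemma sets_multivariate_normal [simp, measurable_cong]: "sets (multivariate_normal m C) = sets borel"
  and space_multivariate_normal [simp]: "space (multivariate_normal m C) = UNIV"
  by (simp_all add: multivariate_normal_def)

lemma borel_measurable_matrix_vector_mult [measurable]:
  fixes A :: "real^'m^'n"
  shows "f \<in> borel_measurable M \<Longrightarrow> (\<lambda>x. A *v f x) \<in> borel_measurable M"
  by (rule measurable_compose[OF _ borel_measurable_linear]) auto

lemma borel_measurable_normal_dens [measurable]: "normal_dens m C \<in> borel_measurable borel"
  unfolding normal_dens_def[abs_def] by measurable

text \<open>The root of det (A A^T) is |det A|, so the normalising constant of the transformed
  density is compensated exactly by the Jacobian.\<close>

lemma normal_dens_affine:
  fixes A :: "real^'n^'n"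
  assumes "invertible A"
  shows "\<bar>det A\<bar> * normal_dens m (A ** transpose A) (m + A *v z) = normal_dens 0 (mat 1) z"
proof -
  have "det A \<noteq> 0"
    using assms invertible_det_nz by blast
  moreover have "matrix_inv (mat 1 :: real^'n^'n) = mat 1"
    by (rule matrix_inv_unique) simp
  moreover have "sqrt ((2 * pi) ^ CARD('n) * (det A * det A)) = sqrt ((2 * pi) ^ CARD('n)) * \<bar>det A\<bar>"
    by (simp add: real_sqrt_mult)
  ultimately show ?thesis
    by (simp add: normal_dens_def inner_matrix_inv_mult_transpose[OF assms] det_mul det_transpose)
qed

lemma normal_dens_nonneg:
  fixes A :: "real^'n^'n"
  shows "0 \<le> normal_dens m (A ** transpose A) x"
  by (simp add: normal_dens_def det_mul det_transpose)

lemma distr_multivariate_normal_affine: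
  fixes A :: "real^'n^'n"
  assumes A: "invertible A"
  shows "distr (multivariate_normal 0 (mat 1)) borel (\<lambda>z. m + A *v z) = multivariate_normal m (A ** transpose A)"
proof (rule measure_eqI)
  fix E assume "E \<in> sets (distr (multivariate_normal 0 (mat 1)) borel (\<lambda>z. m + A *v z))"
  then have E[measurable]: "E \<in> sets borel"
    by simp
  let ?d = "normal_dens m (A ** transpose A)"
  have d: "det A \<noteq> 0"
    using A invertible_det_nz by blast
  have "emeasure (distr (multivariate_normal 0 (mat 1)) borel (\<lambda>z. m + A *v z)) E
      = (\<integral>\<^sup>+z. ennreal (normal_dens 0 (mat 1) z) * indicator E (m + A *v z) \<partial>lborel)"
    by (simp add: multivariate_normal_eq_density nn_integral_distr nn_integral_density flip: nn_integral_indicator)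
  also have "\<dots> = (\<integral>\<^sup>+z. ennreal \<bar>det A\<bar> * (ennreal (?d (m + A *v z)) * indicator E (m + A *v z)) \<partial>lborel)"
    by (simp add: normal_dens_affine[OF A, symmetric, of _ m] ennreal_mult normal_dens_nonneg mult.assoc)
  also have "\<dots> = ennreal \<bar>det A\<bar> * (\<integral>\<^sup>+z. ennreal (?d (m + A *v z)) * indicator E (m + A *v z) \<partial>lborel)"
    by (rule nn_integral_cmult) measurable
  \<comment> \<open>The linear substitution \<open>y = A *v z\<close> absorbs the determinant; what
    remains is a translation by \<open>m\<close>.\<close>
  also have "\<dots> = (\<integral>\<^sup>+y. ennreal (?d (m + y)) * indicator E (m + y) \<partial>lborel)"
    using nn_integral_lborel_linear[of "(*v) A" "\<lambda>y. ennreal (?d (m + y)) * indicator E (m + y)"] d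
    by simp
  also have "\<dots> = (\<integral>\<^sup>+y. ennreal (?d y) * indicator E y \<partial>distr lborel borel ((+) m))"
    by (subst nn_integral_distr) auto
  also have "\<dots> = emeasure (multivariate_normal m (A ** transpose A)) E"
    unfolding lborel_distr_plus by (simp add: multivariate_normal_eq_density emeasure_density)
  finally show "emeasure (distr (multivariate_normal 0 (mat 1)) borel (\<lambda>z. m + A *v z)) E
    = emeasure (multivariate_normal m (A ** transpose A)) E" .
qed simp

section \<open>The standard normal law as a product measure\<close>

lemma PiM_density_lborel:
  fixes f :: "real \<Rightarrow> ennreal"
  assumes [measurable]: "f \<in> borel_measurable borel" and "prob_space (density lborel f)"
  shows "(\<Pi>\<^sub>M i\<in>(UNIV :: 'n::finite set). density lborel f) = density (\<Pi>\<^sub>M i\<in>UNIV. lborel) (\<lambda>x. \<Prod>i\<in>UNIV. f (x i))"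
proof -
  interpret L: product_sigma_finite "\<lambda>_::'n. lborel :: real measure"
    by (simp add: product_sigma_finite_def sigma_finite_lborel)
  interpret D: product_sigma_finite "\<lambda>_::'n. density lborel f"
    using assms(2) by (simp add: product_sigma_finite_def prob_space_imp_sigma_finite)
  show ?thesis
  proof (rule D.PiM_eqI[symmetric])
    show "sets (density (\<Pi>\<^sub>M i\<in>UNIV. lborel) (\<lambda>x. \<Prod>i\<in>UNIV. f (x i))) = sets (\<Pi>\<^sub>M i\<in>(UNIV :: 'n set). density lborel f)"
      by (simp cong: sets_PiM_cong)
    fix E :: "'n \<Rightarrow> real set" assume "\<And>i. i \<in> UNIV \<Longrightarrow> E i \<in> sets (density lborel f)"
    then have [measurable]: "E i \<in> sets borel" for i
      by simp
    have "emeasure (density (\<Pi>\<^sub>M i\<in>UNIV. lborel) (\<lambda>x. \<Prod>i\<in>UNIV. f (x i))) (\<Pi>\<^sub>E i\<in>UNIV. E i)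
       = (\<integral>\<^sup>+x. (\<Prod>i\<in>UNIV. f (x i)) * indicator (\<Pi>\<^sub>E i\<in>UNIV. E i) x \<partial>(\<Pi>\<^sub>M i\<in>UNIV. lborel))"
      by (rule emeasure_density) (auto intro!: sets_PiM_I_finite)
    also have "\<dots> = (\<integral>\<^sup>+x. (\<Prod>i\<in>UNIV. f (x i) * indicator (E i) (x i)) \<partial>(\<Pi>\<^sub>M i\<in>UNIV. lborel))"
      by (intro nn_integral_cong) (auto simp: prod.distrib indicator_def PiE_iff)
    also have "\<dots> = (\<Prod>i\<in>UNIV. emeasure (density lborel f) (E i))"
      by (subst L.product_nn_integral_prod) (auto simp: emeasure_density)
    finally show "emeasure (density (\<Pi>\<^sub>M i\<in>UNIV. lborel) (\<lambda>x. \<Prod>i\<in>UNIV. f (x i))) (\<Pi>\<^sub>E i\<in>UNIV. E i)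
      = (\<Prod>i\<in>UNIV. emeasure (density lborel f) (E i))" .
  qed simp
qed

text \<open>The exponential of a sum of squares factorises over the coordinates. Total mass 1 and
  the joint law of independent entries are both read off from this form.\<close>

lemma multivariate_normal_std_eq_distr_PiM:
  "multivariate_normal 0 (mat 1 :: real^'n^'n)
    = distr (\<Pi>\<^sub>M i\<in>UNIV. std_normal_distribution) borel (\<lambda>x. \<chi> i. x i)"
proof -
  have inv: "matrix_inv (mat 1 :: real^'n^'n) = mat 1"
    by (rule matrix_inv_unique) simp
  have dens: "ennreal (normal_dens 0 (mat 1) (\<chi> i. x i)) = (\<Prod>i\<in>UNIV. ennreal (std_normal_density (x i)))"
    for x :: "'n \<Rightarrow> real"
  proof -
    have "(\<Prod>i\<in>UNIV. ennreal (std_normal_density (x i))) = ennreal (\<Prod>i\<in>UNIV. std_normal_density (x i))"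
      by (rule prod_ennreal) simp
    also have "(\<Prod>i\<in>UNIV. std_normal_density (x i)) = normal_dens 0 (mat 1) (\<chi> i. x i)"
      by (simp add: normal_dens_def inv std_normal_density_def prod_dividef exp_sum[symmetric] inner_vec_def
        real_sqrt_mult power_mult_distrib real_sqrt_power prod.distrib sum_negf sum_divide_distrib[symmetric] power2_eq_square power_one_over)
    finally show ?thesis ..
  qed
  have "multivariate_normal 0 (mat 1 :: real^'n^'n)
      = density (distr (\<Pi>\<^sub>M i\<in>UNIV. lborel) borel (\<lambda>x. \<chi> i. x i)) (normal_dens 0 (mat 1))"
    by (simp add: multivariate_normal_eq_density flip: lborel_vec_eq_distr_PiM)
  also have "\<dots> = distr (density (\<Pi>\<^sub>M i\<in>UNIV. lborel) (\<lambda>x. ennreal (normal_dens 0 (mat 1) (\<chi> i. x i)))) borel (\<lambda>x. \<chi> i. x i)"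
    by (rule density_distr) measurable
  also have "density (\<Pi>\<^sub>M i\<in>(UNIV :: 'n set). lborel) (\<lambda>x. ennreal (normal_dens 0 (mat 1) (\<chi> i. x i)))
     = (\<Pi>\<^sub>M i\<in>UNIV. std_normal_distribution)"
    unfolding dens by (rule PiM_density_lborel[symmetric]) (auto intro: prob_space_normal_density)
  finally show ?thesis .
qed

lemma (in prob_space) distr_iid_std_normal:
  fixes Y :: "'n::finite \<Rightarrow> 'a \<Rightarrow> real"
  assumes ind: "indep_vars (\<lambda>_. borel) Y UNIV"
    and law: "\<And>i. distr M borel (Y i) = std_normal_distribution"
  shows "distr M borel (\<lambda>\<omega>. \<chi> i. Y i \<omega>) = multivariate_normal 0 (mat 1)"
proof -
  have Y[measurable]: "Y i \<in> borel_measurable M" for i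
    using ind by (auto simp: indep_vars_def)
  have "distr M (\<Pi>\<^sub>M i\<in>UNIV. borel) (\<lambda>\<omega>. \<lambda>i\<in>UNIV. Y i \<omega>) = (\<Pi>\<^sub>M i\<in>UNIV. std_normal_distribution)"
    using indep_vars_iff_distr_eq_PiM[where I=UNIV and M'="\<lambda>_. borel" and X=Y] ind by (simp add: law)
  then have "multivariate_normal 0 (mat 1)
      = distr (distr M (\<Pi>\<^sub>M i\<in>UNIV. borel) (\<lambda>\<omega>. \<lambda>i\<in>UNIV. Y i \<omega>)) borel (\<lambda>x. \<chi> i. x i)"
    by (simp add: multivariate_normal_std_eq_distr_PiM)
  also have "\<dots> = distr M borel (\<lambda>\<omega>. \<chi> i. Y i \<omega>)"
  proof (subst distr_distr)
    show "(\<lambda>\<omega>. \<lambda>i\<in>UNIV. Y i \<omega>) \<in> M \<rightarrow>\<^sub>M (\<Pi>\<^sub>M i\<in>UNIV. borel)"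
      by (rule measurable_restrict) simp
  qed (simp_all add: comp_def restrict_def)
  finally show ?thesis ..
qed

text \<open>No Gaussian integral in several variables is computed: the standard law is a product of
  probability measures, and the others are its affine images.\<close>

lemma prob_space_multivariate_normal:
  fixes A :: "real^'n^'n"
  assumes "invertible A"
  shows "prob_space (multivariate_normal m (A ** transpose A))"
proof -
  have "prob_space (multivariate_normal 0 (mat 1 :: real^'n^'n))"
    unfolding multivariate_normal_std_eq_distr_PiM
  proof (rule prob_space.prob_space_distr)
    show "prob_space (\<Pi>\<^sub>M i\<in>(UNIV :: 'n set). std_normal_distribution)"
      by (intro prob_space_PiM prob_space_normal_density) simp
  qed (simp cong: measurable_cong_sets sets_PiM_cong)
  then have "prob_space (distr (multivariate_normal 0 (mat 1)) borel (\<lambda>z. m + A *v z))"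
    by (rule prob_space.prob_space_distr) simp
  then show ?thesis
    by (simp add: distr_multivariate_normal_affine[OF assms])
qed

section \<open>Reversibility and invariance of the Gaussian kernel\<close>

lemma normal_dens_detailed_balance:
  fixes A :: "real^'n^'n" and a b :: real
  assumes A: "invertible A" and b: "b > 0" and ab: "a\<^sup>2 + b\<^sup>2 = 1"
  defines "C \<equiv> A ** transpose A" and "D \<equiv> (b *\<^sub>R A) ** transpose (b *\<^sub>R A)"
  shows "normal_dens 0 C x * normal_dens (a *\<^sub>R x) D y = normal_dens 0 C y * normal_dens (a *\<^sub>R y) D x"
proof -
  have bA: "invertible (b *\<^sub>R A)"
    using scalar_invertible[OF _ A] b by simp
  obtain A' where A': "A ** A' = mat 1" "A' ** A = mat 1"
    using A by (auto simp: invertible_def)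
  define u v where "u = A' *v x" and "v = A' *v y"
  have x: "x = A *v u" and y: "y = A *v v"
    by (simp_all add: u_def v_def matrix_vector_mul_assoc A')
  have C: "(A *v z) \<bullet> (matrix_inv C *v (A *v z)) = z \<bullet> z" for z
    unfolding C_def by (rule inner_matrix_inv_mult_transpose[OF A])
  \<comment> \<open>\<open>D\<close> has factor \<open>b *\<^sub>R A\<close>, so
    \<open>A *v z\<close> has the coordinates \<open>z / b\<close> with respect to it.\<close>
  have D: "(A *v z) \<bullet> (matrix_inv D *v (A *v z)) = (z \<bullet> z) / b\<^sup>2" for z
  proof -
    have "A *v z = (b *\<^sub>R A) *v ((1 / b) *\<^sub>R z)"
      using b by (simp add: scaleR_matrix_vector_assoc[symmetric] matrix_vector_mult_scaleR)
    then show ?thesis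
      using b unfolding D_def by (simp only: inner_matrix_inv_mult_transpose[OF bA]) (simp add: power2_eq_square)
  qed
  have sub: "A *v z - a *\<^sub>R (A *v w) = A *v (z - a *\<^sub>R w)" for z w
    by (simp add: matrix_vector_mult_diff_distrib matrix_vector_mult_scaleR)
  \<comment> \<open>Since 1 + a^2 / b^2 = 1 / b^2, both sides equal (|u|^2 + |v|^2 - 2 a u \<bullet>
    v) / b^2, symmetric in \<open>u\<close> and \<open>v\<close>. The normalising constants do not
    depend on the points, so this identity of exponents is all there is to detailed balance.\<close>
  have key: "u \<bullet> u + (v - a *\<^sub>R u) \<bullet> (v - a *\<^sub>R u) / b\<^sup>2 = v \<bullet> v + (u - a *\<^sub>R v) \<bullet> (u - a *\<^sub>R v) / b\<^sup>2"
  proof -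
    have "u \<bullet> u * b\<^sup>2 + (v - a *\<^sub>R u) \<bullet> (v - a *\<^sub>R u) = u \<bullet> u * (a\<^sup>2 + b\<^sup>2) + v \<bullet> v - 2 * a * (u \<bullet> v)"
      by (simp add: inner_diff inner_commute power2_eq_square algebra_simps)
    also have "\<dots> = v \<bullet> v * (a\<^sup>2 + b\<^sup>2) + u \<bullet> u - 2 * a * (u \<bullet> v)"
      by (simp add: ab)
    also have "\<dots> = v \<bullet> v * b\<^sup>2 + (u - a *\<^sub>R v) \<bullet> (u - a *\<^sub>R v)"
      by (simp add: inner_diff inner_commute power2_eq_square algebra_simps)
    finally show ?thesis
      using b by (simp add: field_simps)
  qed
  have "exp (- (u \<bullet> u) / 2) * exp (- ((v - a *\<^sub>R u) \<bullet> (v - a *\<^sub>R u) / b\<^sup>2) / 2)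
      = exp (- (v \<bullet> v) / 2) * exp (- ((u - a *\<^sub>R v) \<bullet> (u - a *\<^sub>R v) / b\<^sup>2) / 2)"
    using key by (simp add: exp_add[symmetric] field_simps)
  then show ?thesis
    by (simp add: normal_dens_def x y sub C D)
qed

lemma measurable_emeasure_multivariate_normal:
  fixes a :: real
  assumes [measurable]: "E \<in> sets borel"
  shows "(\<lambda>x. emeasure (multivariate_normal (a *\<^sub>R x) D) E) \<in> borel_measurable borel"
proof -
  have [measurable]: "(\<lambda>(x, y). normal_dens (a *\<^sub>R x) D y) \<in> borel_measurable (borel \<Otimes>\<^sub>M borel)"
    unfolding normal_dens_def[abs_def] by measurable
  show ?thesis
    unfolding multivariate_normal_eq_density by (simp add: emeasure_density)
qed

text \<open>Detailed balance exchanges the starting point and the end point; after Fubini the inner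
  integral is the total mass 1 of a transition law, and only the stationary mass of \<open>E\<close>
  is left.\<close>

lemma nn_integral_multivariate_normal_kernel:
  fixes A :: "real^'n^'n" and a b :: real
  assumes A: "invertible A" and b: "b > 0" and ab: "a\<^sup>2 + b\<^sup>2 = 1"
    and E[measurable]: "E \<in> sets borel"
  defines "C \<equiv> A ** transpose A" and "D \<equiv> (b *\<^sub>R A) ** transpose (b *\<^sub>R A)"
  shows "(\<integral>\<^sup>+x. emeasure (multivariate_normal (a *\<^sub>R x) D) E \<partial>multivariate_normal 0 C)
    = emeasure (multivariate_normal 0 C) E"
proof -
  have bA: "invertible (b *\<^sub>R A)"
    using scalar_invertible[OF _ A] b by simp
  have nn: "0 \<le> normal_dens m C x" "0 \<le> normal_dens m D x" for m x
    unfolding C_def D_def by (rule normal_dens_nonneg)+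
  have [measurable]: "(\<lambda>(x, y). normal_dens (a *\<^sub>R x) D y) \<in> borel_measurable (borel \<Otimes>\<^sub>M borel)"
    unfolding normal_dens_def[abs_def] by measurable
  have [measurable]: "(\<lambda>x. emeasure (multivariate_normal (a *\<^sub>R x) D) E) \<in> borel_measurable borel"
    by (rule measurable_emeasure_multivariate_normal[OF E])
  have "(\<integral>\<^sup>+x. emeasure (multivariate_normal (a *\<^sub>R x) D) E \<partial>multivariate_normal 0 C)
      = (\<integral>\<^sup>+x. ennreal (normal_dens 0 C x) * (\<integral>\<^sup>+y. ennreal (normal_dens (a *\<^sub>R x) D y) * indicator E y \<partial>lborel) \<partial>lborel)"
    unfolding multivariate_normal_eq_density by (subst nn_integral_density) (simp_all add: emeasure_density)
  also have "\<dots> = (\<integral>\<^sup>+x. \<integral>\<^sup>+y. ennreal (normal_dens 0 C x) * (ennreal (normal_dens (a *\<^sub>R x) D y) * indicator E y) \<partial>lborel \<partial>lborel)"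
    by (subst nn_integral_cmult) simp_all
  also have "\<dots> = (\<integral>\<^sup>+x. \<integral>\<^sup>+y. ennreal (normal_dens 0 C y) * indicator E y * ennreal (normal_dens (a *\<^sub>R y) D x) \<partial>lborel \<partial>lborel)"
  proof (intro nn_integral_cong)
    fix x y :: "real^'n"
    have "ennreal (normal_dens 0 C x) * ennreal (normal_dens (a *\<^sub>R x) D y)
        = ennreal (normal_dens 0 C y) * ennreal (normal_dens (a *\<^sub>R y) D x)"
      using normal_dens_detailed_balance[OF A b ab, of x y]
      by (simp add: nn C_def[symmetric] D_def[symmetric] flip: ennreal_mult)
    then show "ennreal (normal_dens 0 C x) * (ennreal (normal_dens (a *\<^sub>R x) D y) * indicator E y)
        = ennreal (normal_dens 0 C y) * indicator E y * ennreal (normal_dens (a *\<^sub>R y) D x)"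
      by (metis mult.assoc mult.commute)
  qed
  also have "\<dots> = (\<integral>\<^sup>+y. \<integral>\<^sup>+x. ennreal (normal_dens 0 C y) * indicator E y * ennreal (normal_dens (a *\<^sub>R y) D x) \<partial>lborel \<partial>lborel)"
    by (rule lborel_pair.Fubini') measurable
  also have "\<dots> = (\<integral>\<^sup>+y. ennreal (normal_dens 0 C y) * indicator E y * emeasure (multivariate_normal (a *\<^sub>R y) D) UNIV \<partial>lborel)"
    by (simp add: nn_integral_cmult multivariate_normal_eq_density emeasure_density)
  also have "\<dots> = emeasure (multivariate_normal 0 C) E"
    using prob_space.emeasure_space_1[OF prob_space_multivariate_normal[OF bA]]
    by (simp add: D_def) (simp add: multivariate_normal_eq_density emeasure_density)
  finally show ?thesis .
qed

subsection \<open>Riemann sums of the driving path\<close>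

text \<open>Along a solution \<open>x\<close>, the Riemann sums of \<open>exp (s - t)\<close> against the driving path
  \<open>x s - x 0 + \<integral> x\<close> telescope up to an error that vanishes by uniform continuity. In this form
  neither uniqueness of the solution nor a stochastic integral is needed.\<close>

lemma exp_weighted_increments_tendsto:
  fixes x N :: "real \<Rightarrow> 'a::euclidean_space"
  assumes t: "t > 0" and cont: "continuous_on {0..t} x"
    and N: "\<And>s. s \<in> {0..t} \<Longrightarrow> N s = x s - x 0 + integral {0..s} x"
  shows "(\<lambda>n. \<Sum>k<n. exp (real k * t / real n - t) *\<^sub>R (N (real (Suc k) * t / real n) - N (real k * t / real n)))
    \<longlonglongrightarrow> x t - exp (- t) *\<^sub>R x 0"
proof -
  define \<tau> where "\<tau> n k = real k * t / real n" for n k :: nat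
  define S where "S n = (\<Sum>k<n. exp (\<tau> n k - t) *\<^sub>R (N (\<tau> n (Suc k)) - N (\<tau> n k)))" for n
  \<comment> \<open>\<open>exp h - 1 - h\<close> is of second order in h, so \<open>n\<close> cells
    of length h = t / n contribute an error of order 1 / n.\<close>
  define r where "r n = real n * (exp (t / real n) - 1 - t / real n)" for n
  have \<tau>: "0 \<le> \<tau> n k" "\<tau> n k \<le> t" if "k \<le> n" for n k
    using that t by (cases "n = 0"; simp add: \<tau>_def field_simps)+
  have \<tau>_Suc: "\<tau> n (Suc k) = \<tau> n k + t / real n" for n k
    by (simp add: \<tau>_def field_simps add_divide_distrib)
  have "bounded (x ` {0..t})"
    by (intro compact_imp_bounded compact_continuous_image cont) simp
  then obtain K where K: "\<And>s. s \<in> {0..t} \<Longrightarrow> norm (x s) \<le> K"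
    unfolding bounded_iff by blast
  have K0: "K \<ge> 0"
    using K[of 0] t norm_ge_zero[of "x 0"] by (simp add: order_trans[OF norm_ge_zero])
  have r: "r \<longlonglongrightarrow> 0"
    unfolding r_def using t by real_asymp
  \<comment> \<open>Two errors accumulate over the cells: the oscillation \<open>e\<close> of the
    path within a cell, with total weight \<open>t\<close>, and the defect \<open>r n\<close> of
    linearising the exponential, weighted by the bound \<open>K\<close> on the path.\<close>
  have bound: "norm (S n - (x t - exp (- t) *\<^sub>R x 0)) \<le> t * e + K * r n"
    if n: "n > 0" and e: "e > 0"
      and osc: "\<And>s s'. s \<in> {0..t} \<Longrightarrow> s' \<in> {0..t} \<Longrightarrow> \<bar>s - s'\<bar> \<le> t / real n \<Longrightarrow> norm (x s - x s') \<le> e" for n e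
  proof -
    define h where "h = t / real n"
    have h: "h > 0" "real n * h = t"
      using n t by (simp_all add: h_def)
    have exph: "exp h - 1 - h \<ge> 0"
      using exp_ge_add_one_self[of h] by linarith
    define F where "F k = exp (\<tau> n k - t) *\<^sub>R x (\<tau> n k)" for k
    have "x t - exp (- t) *\<^sub>R x 0 = F n - F 0"
      using n by (simp add: F_def \<tau>_def)
    also have "\<dots> = (\<Sum>k<n. F (Suc k) - F k)"
      by (rule sum_lessThan_telescope[symmetric])
    finally have "S n - (x t - exp (- t) *\<^sub>R x 0)
        = (\<Sum>k<n. exp (\<tau> n k - t) *\<^sub>R (N (\<tau> n (Suc k)) - N (\<tau> n k)) - (F (Suc k) - F k))"
      by (simp add: S_def sum_subtractf)
    also have "norm \<dots> \<le> (\<Sum>k<n. h * e + (exp h - 1 - h) * K)"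
    proof (rule sum_norm_le)
      fix k assume "k \<in> {..<n}"
      then have k: "k < n" by simp
      define a b where "a = \<tau> n k" and "b = \<tau> n (Suc k)"
      have ab: "b = a + h" "0 \<le> a" "b \<le> t"
        using \<tau>[of k n] \<tau>[of "Suc k" n] k by (auto simp: a_def b_def h_def \<tau>_Suc)
      have int: "x integrable_on {0..b}" "x integrable_on {a..b}"
        by (intro integrable_continuous_interval continuous_on_subset[OF cont]; use ab h in auto)+
      have "integral {0..b} x = integral {0..a} x + integral {a..b} x"
        using ab h by (intro Henstock_Kurzweil_Integration.integral_combine[symmetric] int) auto
      then have "N b - N a = x b - x a + integral {a..b} x"
        using N[of a] N[of b] ab(2,3) h by (simp add: ab(1))
      \<comment> \<open>The right endpoint serves as reference value: in the cell error
        \<open>x a\<close> then cancels and \<open>x b\<close> keeps only the second-order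
        coefficient \<open>exp h - 1 - h\<close>.\<close>
      moreover have "integral {a..b} x = integral {a..b} (\<lambda>s. x s - x b) + h *\<^sub>R x b"
        using ab(1) h(1) by (subst integral_diff[OF int(2)]) auto
      ultimately have Nab: "N b - N a = x b - x a + (integral {a..b} (\<lambda>s. x s - x b) + h *\<^sub>R x b)"
        by simp
      have "exp (b - t) = exp (a - t) * exp h"
        by (simp add: ab exp_add[symmetric])
      then have eq: "exp (a - t) *\<^sub>R (N b - N a) - (exp (b - t) *\<^sub>R x b - exp (a - t) *\<^sub>R x a)
          = exp (a - t) *\<^sub>R (integral {a..b} (\<lambda>s. x s - x b) - (exp h - 1 - h) *\<^sub>R x b)"
        unfolding Nab by (simp add: algebra_simps)
      have "norm (integral {a..b} (\<lambda>s. x s - x b)) \<le> e * (b - a)"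
        using ab h e
        by (intro integral_bound continuous_intros continuous_on_subset[OF cont]) (auto simp: h_def intro!: osc)
      moreover have "norm ((exp h - 1 - h) *\<^sub>R x b) \<le> (exp h - 1 - h) * K"
        using exph K[of b] ab h by (simp add: mult_left_mono)
      ultimately have "norm (integral {a..b} (\<lambda>s. x s - x b) - (exp h - 1 - h) *\<^sub>R x b) \<le> h * e + (exp h - 1 - h) * K"
        using norm_triangle_ineq4[of "integral {a..b} (\<lambda>s. x s - x b)" "(exp h - 1 - h) *\<^sub>R x b"] ab
        by (simp add: mult.commute)
      moreover have "exp (a - t) \<le> 1"
        using ab h by simp
      ultimately have "exp (a - t) * norm (integral {a..b} (\<lambda>s. x s - x b) - (exp h - 1 - h) *\<^sub>R x b)
          \<le> 1 * (h * e + (exp h - 1 - h) * K)"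
        by (intro mult_mono) auto
      then have "norm (exp (a - t) *\<^sub>R (integral {a..b} (\<lambda>s. x s - x b) - (exp h - 1 - h) *\<^sub>R x b))
          \<le> h * e + (exp h - 1 - h) * K"
        by simp
      then show "norm (exp (\<tau> n k - t) *\<^sub>R (N (\<tau> n (Suc k)) - N (\<tau> n k)) - (F (Suc k) - F k)) \<le> h * e + (exp h - 1 - h) * K"
        unfolding F_def a_def[symmetric] b_def[symmetric] eq .
    qed
    also have "\<dots> = (real n * h) * e + K * r n"
      by (simp add: r_def h_def algebra_simps)
    finally show ?thesis
      by (simp add: h)
  qed
  have "S \<longlonglongrightarrow> x t - exp (- t) *\<^sub>R x 0"
  proof (rule metric_LIMSEQ_I)
    fix \<epsilon> :: real assume \<epsilon>: "\<epsilon> > 0"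
    define e where "e = \<epsilon> / (2 * t)"
    have e: "e > 0" "t * e = \<epsilon> / 2"
      using \<epsilon> t by (simp_all add: e_def)
    have "uniformly_continuous_on {0..t} x"
      by (intro compact_uniformly_continuous cont) simp
    then obtain \<delta> where \<delta>: "\<delta> > 0"
      and uc: "\<And>s s'. s \<in> {0..t} \<Longrightarrow> s' \<in> {0..t} \<Longrightarrow> dist s' s < \<delta> \<Longrightarrow> dist (x s') (x s) < e"
      using e(1) unfolding uniformly_continuous_on_def by metis
    have "(\<lambda>n. t / real n) \<longlonglongrightarrow> 0"
      by real_asymp
    then have ev1: "\<forall>\<^sub>F n in sequentially. t / real n < \<delta>"
      using \<delta> by (rule order_tendstoD)
    have "(\<lambda>n. K * r n) \<longlonglongrightarrow> 0"
      using tendsto_mult_left[OF r, of K] by simp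
    then have ev2: "\<forall>\<^sub>F n in sequentially. K * r n < \<epsilon> / 2"
      using \<epsilon> by (intro order_tendstoD) auto
    from ev1 ev2 eventually_gt_at_top[of 0] have "\<forall>\<^sub>F n in sequentially. dist (S n) (x t - exp (- t) *\<^sub>R x 0) < \<epsilon>"
    proof eventually_elim
      case (elim n)
      have "norm (S n - (x t - exp (- t) *\<^sub>R x 0)) \<le> t * e + K * r n"
      proof (rule bound)
        fix s s' assume s: "s \<in> {0..t}" "s' \<in> {0..t}" "\<bar>s - s'\<bar> \<le> t / real n"
        then have "dist (x s) (x s') < e"
          using elim by (intro uc) (auto simp: dist_real_def)
        then show "norm (x s - x s') \<le> e"
          by (simp add: dist_norm)
      qed (use elim e in auto)
      with elim e show ?case
        by (simp add: dist_norm)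
    qed
    then show "\<exists>no. \<forall>n\<ge>no. dist (S n) (x t - exp (- t) *\<^sub>R x 0) < \<epsilon>"
      by (simp add: eventually_sequentially)
  qed
  then show ?thesis
    by (simp add: S_def[abs_def] \<tau>_def)
qed

section \<open>Riemann sums of unit variance along a Brownian path\<close>

definition ou_variance :: "real \<Rightarrow> nat \<Rightarrow> real" where
  "ou_variance t n = (\<Sum>k<n. (exp (real k * t / real n - t))\<^sup>2 * (t / real n))"

text \<open>Riemann sums for \<open>\<integral> exp (s - t) dp(s)\<close> over \<open>[0, t]\<close>, scaled to unit variance when \<open>p\<close> is a
  Brownian path.\<close>

definition ou_sum :: "real \<Rightarrow> (real \<Rightarrow> real) \<Rightarrow> nat \<Rightarrow> real" where
  "ou_sum t p n = (\<Sum>k<n. exp (real k * t / real n - t) / sqrt (ou_variance t n)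
     * (p (real (Suc k) * t / real n) - p (real k * t / real n)))"

lemma ou_variance_pos: "t > 0 \<Longrightarrow> n > 0 \<Longrightarrow> ou_variance t n > 0"
  unfolding ou_variance_def by (intro sum_pos) auto

text \<open>\<open>ou_variance t n\<close> is a left Riemann sum of exp (2 (s - t)) over [0, t], and
  also a geometric sum with ratio exp (2 t / n). The closed form leaves only (t / n) / (1 - exp (2 t
  / n)), which tends to - 1 / 2.\<close>

lemma ou_variance_tendsto:
  assumes t: "t > 0"
  shows "ou_variance t \<longlonglongrightarrow> (1 - exp (- 2 * t)) / 2"
proof -
  have eq: "ou_variance t n = exp (- 2 * t) * (1 - exp (2 * t)) * ((t / real n) / (1 - exp (2 * t / real n)))"
    if n: "n > 0" for n
  proof -
    have "(exp (real k * t / real n - t))\<^sup>2 = exp (- 2 * t) * exp (2 * t / real n) ^ k" for k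
      by (simp add: exp_of_nat_mult[symmetric] power2_eq_square exp_add[symmetric])
    then have "ou_variance t n = exp (- 2 * t) * (t / real n) * (\<Sum>k<n. exp (2 * t / real n) ^ k)"
      by (simp add: ou_variance_def sum_distrib_left mult_ac)
    also have "(\<Sum>k<n. exp (2 * t / real n) ^ k) = (1 - exp (2 * t / real n) ^ n) / (1 - exp (2 * t / real n))"
      using n t by (subst sum_gp_strict) simp
    also have "exp (2 * t / real n) ^ n = exp (2 * t)"
      using n by (simp add: exp_of_nat_mult[symmetric])
    finally show ?thesis
      by simp
  qed
  have lim: "(\<lambda>n. exp (- 2 * t) * (1 - exp (2 * t)) * ((t / real n) / (1 - exp (2 * t / real n))))
      \<longlonglongrightarrow> exp (- 2 * t) * (1 - exp (2 * t)) * (- 1 / 2)"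
  proof (rule tendsto_mult_left)
    show "(\<lambda>n. (t / real n) / (1 - exp (2 * t / real n))) \<longlonglongrightarrow> - 1 / 2"
      using t by real_asymp
  qed
  have "ou_variance t \<longlonglongrightarrow> exp (- 2 * t) * (1 - exp (2 * t)) * (- 1 / 2)"
    by (rule Lim_transform_eventually[OF lim], rule eventually_mono[OF eventually_gt_at_top[of 0]])
       (rule eq[symmetric])
  also have "exp (- 2 * t) * (1 - exp (2 * t)) * (- 1 / 2) = (1 - exp (- 2 * t)) / 2"
    by (simp add: algebra_simps exp_add[symmetric])
  finally show ?thesis .
qed

text \<open>The weights are deterministic and the increments over disjoint cells are independent and
  normal, so the sum is normal for each \<open>n\<close>; division by the standard deviation makes
  the law independent of \<open>n\<close>.\<close>

lemma distr_ou_sum_brownian_motion: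
  assumes W: "std_brownian_motion M W" and t: "t > 0" and n: "n > 0"
  shows "distr M borel (\<lambda>\<omega>. ou_sum t (\<lambda>s. W s \<omega>) n) = std_normal_distribution"
proof -
  interpret prob_space M
    using W by (simp add: std_brownian_motion_def)
  define \<tau> where "\<tau> k = real k * t / real n" for k
  define c where "c k = exp (\<tau> k - t) / sqrt (ou_variance t n)" for k
  have v: "ou_variance t n > 0"
    by (rule ou_variance_pos[OF t n])
  have c: "c k > 0" for k
    using v by (simp add: c_def)
  have \<tau>: "\<tau> 0 = 0" "mono \<tau>" "\<tau> (Suc k) - \<tau> k = t / real n" "\<tau> k < \<tau> (Suc k)" "0 \<le> \<tau> k" for k
    using t n by (auto simp: \<tau>_def mono_def field_simps)
  have ind: "indep_vars (\<lambda>_. borel) (\<lambda>k \<omega>. W (\<tau> (Suc k)) \<omega> - W (\<tau> k) \<omega>) {..<n}"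
    using W \<tau>(1,2) by (simp add: std_brownian_motion_def)
  have ind': "indep_vars (\<lambda>_. borel) (\<lambda>k \<omega>. c k * (W (\<tau> (Suc k)) \<omega> - W (\<tau> k) \<omega>)) {..<n}"
    by (rule indep_vars_compose2[OF ind]) simp
  have "distributed M lborel (\<lambda>\<omega>. \<Sum>k<n. c k * (W (\<tau> (Suc k)) \<omega> - W (\<tau> k) \<omega>))
    (normal_density (\<Sum>k<n. 0) (sqrt (\<Sum>k<n. (c k * sqrt (t / real n))\<^sup>2)))"
  proof (rule sum_indep_normal[OF _ _ ind'])
    fix k
    have "distributed M lborel (\<lambda>\<omega>. W (\<tau> (Suc k)) \<omega> - W (\<tau> k) \<omega>) (normal_density 0 (sqrt (\<tau> (Suc k) - \<tau> k)))"
      using W \<tau>(4,5)[of k] by (auto simp: std_brownian_motion_def)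
    from normal_density_affine[OF this, of "c k" 0] c[of k] t n
    show "distributed M lborel (\<lambda>\<omega>. c k * (W (\<tau> (Suc k)) \<omega> - W (\<tau> k) \<omega>)) (normal_density 0 (c k * sqrt (t / real n)))"
      by (simp add: \<tau>(3))
  qed (use c t n in auto)
  moreover have "(\<Sum>k<n. (c k * sqrt (t / real n))\<^sup>2) = 1"
  proof -
    have "(\<Sum>k<n. (c k * sqrt (t / real n))\<^sup>2) = (\<Sum>k<n. (exp (\<tau> k - t))\<^sup>2 * (t / real n)) / ou_variance t n"
      using v t n by (simp add: c_def power_mult_distrib power_divide sum_divide_distrib)
    then show ?thesis
      using v by (simp add: ou_variance_def \<tau>_def)
  qed
  ultimately have "distributed M lborel (\<lambda>\<omega>. ou_sum t (\<lambda>s. W s \<omega>) n) std_normal_density"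
    by (simp add: ou_sum_def c_def \<tau>_def)
  then show ?thesis
    by (simp add: distributed_def cong: distr_cong)
qed

text \<open>The characteristic functions converge by dominated convergence, \<open>iexp\<close>
  being bounded by 1, while their values are constant in \<open>n\<close>. The index 0 is left out
  because an empty Riemann sum is not normal.\<close>

lemma (in prob_space) distr_eq_of_AE_tendsto:
  fixes Y :: "nat \<Rightarrow> 'a \<Rightarrow> real"
  assumes [measurable]: "\<And>n. Y n \<in> borel_measurable M" "Z \<in> borel_measurable M"
    and lim: "AE \<omega> in M. (\<lambda>n. Y n \<omega>) \<longlonglongrightarrow> Z \<omega>"
    and law: "\<And>n. n > 0 \<Longrightarrow> distr M borel (Y n) = \<mu>"
  shows "distr M borel Z = \<mu>"
proof (rule Levy_uniqueness)
  show "real_distribution (distr M borel Z)"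
    by (rule real_distribution_distr) simp
  have "real_distribution (distr M borel (Y 1))"
    by (rule real_distribution_distr) simp
  then show "real_distribution \<mu>"
    by (simp add: law)
  show "char (distr M borel Z) = char \<mu>"
  proof
    fix u
    have "(\<lambda>n. \<integral>\<omega>. iexp (u * Y n \<omega>) \<partial>M) \<longlonglongrightarrow> (\<integral>\<omega>. iexp (u * Z \<omega>) \<partial>M)"
    proof (rule integral_dominated_convergence[where w="\<lambda>_. 1"])
      show "AE \<omega> in M. (\<lambda>n. iexp (u * Y n \<omega>)) \<longlonglongrightarrow> iexp (u * Z \<omega>)"
        using lim by eventually_elim (intro tendsto_intros)
    qed auto
    moreover have "\<forall>\<^sub>F n in sequentially. (\<integral>\<omega>. iexp (u * Y n \<omega>) \<partial>M) = char \<mu> u"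
      using eventually_gt_at_top[of 0]
    proof eventually_elim
      case (elim n)
      show ?case
        unfolding law[OF elim, symmetric] char_def by (subst integral_distr) auto
    qed
    ultimately have "(\<lambda>n. char \<mu> u) \<longlonglongrightarrow> (\<integral>\<omega>. iexp (u * Z \<omega>) \<partial>M)"
      by (rule Lim_transform_eventually)
    then have "(\<integral>\<omega>. iexp (u * Z \<omega>) \<partial>M) = char \<mu> u"
      by (simp add: LIMSEQ_const_iff)
    then show "char (distr M borel Z) u = char \<mu> u"
      unfolding char_def[of "distr M borel Z"] by (subst integral_distr) auto
  qed
qed

subsection \<open>The matrix Ornstein--Uhlenbeck process\<close>

text \<open>Only finitely many evaluations of the path enter, all at nonnegative times.
  Measurability for the product sigma-algebra of paths is what transfers independence from paths to
  sums.\<close>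

lemma measurable_ou_sum:
  assumes "t > 0"
  shows "(\<lambda>p. ou_sum t p n) \<in> borel_measurable (PiM {0..} (\<lambda>_. borel))"
proof -
  have [measurable]: "(\<lambda>p. p s) \<in> borel_measurable (PiM {0..} (\<lambda>_. borel))" if "s \<ge> 0" for s :: real
    using that by (intro measurable_component_singleton) simp
  show ?thesis
    unfolding ou_sum_def using assms
    by (intro borel_measurable_sum borel_measurable_times borel_measurable_diff borel_measurable_const) simp_all
qed

lemma (in prob_space) distr_matrix_ou_sum_limit:
  fixes B :: "real \<Rightarrow> 'a \<Rightarrow> real^'d^'nu"
  assumes B: "matrix_brownian_motion M B" and t: "t > 0"
    and Z[measurable]: "Z \<in> borel_measurable M"
    and lim: "AE \<omega> in M. \<forall>i j. (\<lambda>n. ou_sum t (\<lambda>s. B s \<omega> $ i $ j) n) \<longlonglongrightarrow> Z \<omega> $ i $ j"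
  shows "has_matrix_normal_law M Z 0 (mat 1)"
proof -
  define path where "path p \<omega> = (\<lambda>s\<in>{0..}. B s \<omega> $ fst p $ snd p)" for p :: "'nu \<times> 'd" and \<omega>
  \<comment> \<open>\<open>Z\<close> is known to be the limit only almost surely. \<open>lim\<close>
    has some value even where the sums diverge, so each \<open>Y p\<close> is a measurable function
    of a single path everywhere, and the \<open>Y p\<close> are independent.\<close>
  define Y where "Y p \<omega> = lim (ou_sum t (path p \<omega>))" for p \<omega>
  have ind: "indep_vars (\<lambda>_. PiM {0..} (\<lambda>_. borel)) path UNIV"
    using B by (simp add: matrix_brownian_motion_def path_def[abs_def])
  have path[measurable]: "path p \<in> M \<rightarrow>\<^sub>M PiM {0..} (\<lambda>_. borel)" for p
    using ind unfolding indep_vars_def by blast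
  note [measurable] = measurable_ou_sum[OF t]
  have indY: "indep_vars (\<lambda>_. borel) Y UNIV"
    unfolding Y_def[abs_def] by (rule indep_vars_compose2[OF ind]) measurable
  have Y[measurable]: "Y p \<in> borel_measurable M" for p
    using indY unfolding indep_vars_def by blast
  have sum_path: "ou_sum t (path p \<omega>) n = ou_sum t (\<lambda>s. B s \<omega> $ fst p $ snd p) n" for p \<omega> n
    using t by (simp add: ou_sum_def path_def)
  have YZ: "AE \<omega> in M. \<forall>p. Y p \<omega> = Z \<omega> $ fst p $ snd p"
    using lim by eventually_elim (simp add: Y_def sum_path[abs_def] limI)
  have law: "distr M borel (Y p) = std_normal_distribution" for p
  proof (rule distr_eq_of_AE_tendsto)
    show "(\<lambda>\<omega>. ou_sum t (path p \<omega>) n) \<in> borel_measurable M" for n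
      by measurable
    show "AE \<omega> in M. (\<lambda>n. ou_sum t (path p \<omega>) n) \<longlonglongrightarrow> Y p \<omega>"
      using lim YZ by eventually_elim (cases p; simp add: sum_path)
    show "distr M borel (\<lambda>\<omega>. ou_sum t (path p \<omega>) n) = std_normal_distribution" if "n > 0" for n
      unfolding sum_path using B that t
      by (intro distr_ou_sum_brownian_motion) (auto simp: matrix_brownian_motion_def)
  qed measurable
  have "distr M borel (\<lambda>\<omega>. vec_cols (transpose (Z \<omega>))) = distr M borel (\<lambda>\<omega>. \<chi> p. Y p \<omega>)"
  proof (rule distr_cong_AE)
    show "AE \<omega> in M. vec_cols (transpose (Z \<omega>)) = (\<chi> p. Y p \<omega>)"
      using YZ by eventually_elim (simp add: vec_cols_def transpose_def vec_eq_iff)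
  qed (auto intro: measurable_compose[OF Z measurable_vec_cols_transpose] borel_measurable_vec_lambda)
  also have "\<dots> = multivariate_normal 0 (mat 1)"
    by (rule distr_iid_std_normal[OF indY law])
  finally show ?thesis
    by (simp add: has_matrix_normal_law_def vec_cols_def transpose_def zero_vec_def)
qed

lemma matrix_mult_scaleR:
  fixes A :: "real^'n^'m" and B :: "real^'k^'n"
  shows "A ** (c *\<^sub>R B) = c *\<^sub>R (A ** B)" and "(c *\<^sub>R A) ** B = c *\<^sub>R (A ** B)"
  by (simp_all add: matrix_scalar_ac scalar_matrix_assoc)

lemma matrix_add_rdistrib:
  fixes A B :: "real^'n^'m"
  shows "(A + B) ** C = A ** C + B ** C"
  by (simp add: matrix_matrix_mult_def vec_eq_iff sum.distrib distrib_right)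

lemma bounded_linear_matrix_sandwich: "bounded_linear (\<lambda>Z. (P :: real^'n^'m) ** (Z :: real^'k^'n) ** (S :: real^'l^'k))"
  unfolding linear_conv_bounded_linear[symmetric]
  by (rule linearI) (simp_all add: matrix_add_ldistrib matrix_mult_scaleR matrix_add_rdistrib)

text \<open>The equation for \<open>X t\<close> holds by the choice of \<open>Z\<close>; the content
  is the law of \<open>Z\<close>, found by recognising its entries as limits of the normalised sums
  over the Brownian entries.\<close>

lemma matrix_OU_solution_representation:
  fixes B :: "real \<Rightarrow> 'w \<Rightarrow> real^'d^'nu"
  assumes \<Psi>: "sym_posdef \<Psi>" and \<Sigma>: "sym_posdef \<Sigma>" and M: "prob_space M" and B: "matrix_brownian_motion M B"
    and X: "matrix_OU_solution M B \<Psi> \<Sigma> x X" and t: "t > 0"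
  obtains Z where "has_matrix_normal_law M Z 0 (mat 1)"
    "AE \<omega> in M. X t \<omega> = exp (- t) *\<^sub>R x + sqrt (1 - exp (- 2 * t)) *\<^sub>R (sym_sqrt \<Psi> ** Z \<omega> ** sym_sqrt \<Sigma>)"
proof -
  interpret prob_space M by (rule M)
  define P S where "P = sym_sqrt \<Psi>" and "S = sym_sqrt \<Sigma>"
  obtain P' where P': "P ** P' = mat 1" "P' ** P = mat 1"
    using invertible_sym_sqrt[OF \<Psi>] by (auto simp: invertible_def P_def)
  obtain S' where S': "S ** S' = mat 1" "S' ** S = mat 1"
    using invertible_sym_sqrt[OF \<Sigma>] by (auto simp: invertible_def S_def)
  have PS: "P ** (P' ** Y ** S') ** S = Y" "P' ** (P ** Y ** S) ** S' = Y" for Y :: "real^'d^'nu"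
  proof -
    have "P ** (P' ** Y ** S') ** S = (P ** P') ** Y ** (S' ** S)"
      by (simp only: matrix_mul_assoc)
    then show "P ** (P' ** Y ** S') ** S = Y"
      by (simp add: P' S')
    have "P' ** (P ** Y ** S) ** S' = (P' ** P) ** Y ** (S ** S')"
      by (simp only: matrix_mul_assoc)
    then show "P' ** (P ** Y ** S) ** S' = Y"
      by (simp add: P' S')
  qed
  define s where "s = sqrt (1 - exp (- 2 * t))"
  have s: "s > 0"
    using t by (simp add: s_def)
  interpret L: bounded_linear "\<lambda>Y. P' ** (Y :: real^'d^'nu) ** S'"
    by (rule bounded_linear_matrix_sandwich)
  \<comment> \<open>Obtained by solving the claimed representation for \<open>Z\<close>.\<close>
  define Z where "Z \<omega> = (1 / s) *\<^sub>R (P' ** (X t \<omega> - exp (- t) *\<^sub>R x) ** S')" for \<omega>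
  have X_eq: "X t \<omega> = exp (- t) *\<^sub>R x + s *\<^sub>R (P ** Z \<omega> ** S)" for \<omega>
    using s by (simp add: Z_def matrix_mult_scaleR PS)
  have [measurable]: "X t \<in> borel_measurable M"
    using X t by (simp add: matrix_OU_solution_def)
  have [measurable]: "Z \<in> borel_measurable M"
    unfolding Z_def
    by (intro borel_measurable_scaleR borel_measurable_const measurable_compose[OF _ borel_measurable_linear[OF L.linear_axioms]])
       measurable
  have conv: "(\<lambda>n. ou_sum t (\<lambda>r. B r \<omega> $ i $ j) n) \<longlonglongrightarrow> Z \<omega> $ i $ j"
    if X0: "X 0 \<omega> = x" and cont: "continuous_on {0..} (\<lambda>t. X t \<omega>)"
      and eq: "\<forall>t\<ge>0. X t \<omega> = X 0 \<omega> - integral {0..t} (\<lambda>s. X s \<omega>) + sqrt 2 *\<^sub>R (P ** (B t \<omega> - B 0 \<omega>) ** S)"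
    for \<omega> i j
  proof -
    define N where "N r = sqrt 2 *\<^sub>R (P ** (B r \<omega> - B 0 \<omega>) ** S)" for r
    \<comment> \<open>The two-sided multiplication by the inverse roots is linear, so it can be
      taken through the sums and turns increments of the driving path into those of
      \<open>B\<close>.\<close>
    have N: "(1 / sqrt 2) *\<^sub>R (P' ** (N b - N a) ** S') = B b \<omega> - B a \<omega>" for a b
      by (simp add: N_def L.diff L.scaleR matrix_mult_scaleR PS algebra_simps)
    have "(\<lambda>n. \<Sum>k<n. exp (real k * t / real n - t) *\<^sub>R (N (real (Suc k) * t / real n) - N (real k * t / real n)))
      \<longlonglongrightarrow> X t \<omega> - exp (- t) *\<^sub>R X 0 \<omega>"
    proof (rule exp_weighted_increments_tendsto[OF t])
      show "continuous_on {0..t} (\<lambda>t. X t \<omega>)"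
        by (rule continuous_on_subset[OF cont]) auto
      show "N r = X r \<omega> - X 0 \<omega> + integral {0..r} (\<lambda>t. X t \<omega>)" if "r \<in> {0..t}" for r
      proof -
        have "0 \<le> r"
          using that by simp
        then have "X r \<omega> = X 0 \<omega> - integral {0..r} (\<lambda>s. X s \<omega>) + N r"
          using eq unfolding N_def by blast
        then show ?thesis
          by simp
      qed
    qed
    then have "(\<lambda>n. (1 / sqrt 2) *\<^sub>R (P' ** (\<Sum>k<n. exp (real k * t / real n - t) *\<^sub>R (N (real (Suc k) * t / real n) - N (real k * t / real n))) ** S'))
        \<longlonglongrightarrow> (1 / sqrt 2) *\<^sub>R (P' ** (X t \<omega> - exp (- t) *\<^sub>R x) ** S')"
      unfolding X0 by (intro tendsto_scaleR tendsto_const L.tendsto)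
    also have "(1 / sqrt 2) *\<^sub>R (P' ** (X t \<omega> - exp (- t) *\<^sub>R x) ** S') = (s / sqrt 2) *\<^sub>R Z \<omega>"
      using s by (simp add: Z_def)
    finally have "(\<lambda>n. \<Sum>k<n. exp (real k * t / real n - t) *\<^sub>R ((1 / sqrt 2) *\<^sub>R (P' ** (N (real (Suc k) * t / real n) - N (real k * t / real n)) ** S')))
        \<longlonglongrightarrow> (s / sqrt 2) *\<^sub>R Z \<omega>"
      by (simp only: L.sum L.scaleR scaleR_sum_right scaleR_left_commute)
    then have "(\<lambda>n. \<Sum>k<n. exp (real k * t / real n - t) *\<^sub>R (B (real (Suc k) * t / real n) \<omega> - B (real k * t / real n) \<omega>))
        \<longlonglongrightarrow> (s / sqrt 2) *\<^sub>R Z \<omega>"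
      by (simp only: N)
    then have lim: "(\<lambda>n. (\<Sum>k<n. exp (real k * t / real n - t) *\<^sub>R (B (real (Suc k) * t / real n) \<omega> - B (real k * t / real n) \<omega>)) $ i $ j)
        \<longlonglongrightarrow> ((s / sqrt 2) *\<^sub>R Z \<omega>) $ i $ j"
      by (intro tendsto_vec_nth)
    have "(\<lambda>n. sqrt (ou_variance t n)) \<longlonglongrightarrow> sqrt ((1 - exp (- 2 * t)) / 2)"
      by (intro tendsto_real_sqrt ou_variance_tendsto t)
    \<comment> \<open>The same factor \<open>s / sqrt 2\<close> stands before \<open>Z\<close> in
      the limit of the unnormalised sums, so the quotient tends to \<open>Z\<close> itself.\<close>
    then have var: "(\<lambda>n. sqrt (ou_variance t n)) \<longlonglongrightarrow> s / sqrt 2"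
      by (simp add: s_def real_sqrt_divide)
    have "ou_sum t (\<lambda>r. B r \<omega> $ i $ j) n
        = (\<Sum>k<n. exp (real k * t / real n - t) *\<^sub>R (B (real (Suc k) * t / real n) \<omega> - B (real k * t / real n) \<omega>)) $ i $ j
          / sqrt (ou_variance t n)" for n
      by (simp add: ou_sum_def sum_divide_distrib)
    then show ?thesis
      using tendsto_divide[OF lim var] s by simp
  qed
  have "has_matrix_normal_law M Z 0 (mat 1)"
  proof (rule distr_matrix_ou_sum_limit[OF B t])
    have "AE \<omega> in M. X 0 \<omega> = x" "AE \<omega> in M. continuous_on {0..} (\<lambda>t. X t \<omega>)"
      "AE \<omega> in M. \<forall>t\<ge>0. X t \<omega> = X 0 \<omega> - integral {0..t} (\<lambda>s. X s \<omega>) + sqrt 2 *\<^sub>R (P ** (B t \<omega> - B 0 \<omega>) ** S)"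
      using X by (simp_all add: matrix_OU_solution_def P_def S_def)
    then show "AE \<omega> in M. \<forall>i j. (\<lambda>n. ou_sum t (\<lambda>s. B s \<omega> $ i $ j) n) \<longlonglongrightarrow> Z \<omega> $ i $ j"
      by eventually_elim (intro allI, rule conv)
  qed measurable
  then show thesis
    by (rule that) (simp add: X_eq s_def P_def S_def)
qed

section \<open>Matrix normal laws and the transition kernel\<close>

lemma kron_sym_sqrt:
  assumes "sym_posdef \<Psi>" "sym_posdef \<Sigma>"
  shows "kron (sym_sqrt \<Psi>) (sym_sqrt \<Sigma>) ** transpose (kron (sym_sqrt \<Psi>) (sym_sqrt \<Sigma>)) = kron \<Psi> \<Sigma>"
    and "invertible (kron (sym_sqrt \<Psi>) (sym_sqrt \<Sigma>))"
    and "transpose (sym_sqrt \<Sigma>) = sym_sqrt \<Sigma>"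
proof -
  have P: "transpose (sym_sqrt \<Psi>) = sym_sqrt \<Psi>" and S: "transpose (sym_sqrt \<Sigma>) = sym_sqrt \<Sigma>"
    using assms[THEN sym_posdef_imp_sym_possemidef, THEN sym_possemidef_sym_sqrt]
    by (simp_all add: sym_possemidef_def)
  then show "transpose (sym_sqrt \<Sigma>) = sym_sqrt \<Sigma>"
    by simp
  show "kron (sym_sqrt \<Psi>) (sym_sqrt \<Sigma>) ** transpose (kron (sym_sqrt \<Psi>) (sym_sqrt \<Sigma>)) = kron \<Psi> \<Sigma>"
    using assms by (simp add: transpose_kron P S kron_mult sym_sqrt_mult_self sym_posdef_imp_sym_possemidef)
  show "invertible (kron (sym_sqrt \<Psi>) (sym_sqrt \<Sigma>))"
    using assms by (intro invertible_kron invertible_sym_sqrt)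
qed

text \<open>After vectorisation the map is affine with linear part \<open>s\<close> times the
  Kronecker product of the two roots, and that factor times its transpose is the stated
  covariance.\<close>

lemma has_matrix_normal_law_affine:
  fixes Z :: "'w \<Rightarrow> real^'d^'nu"
  assumes \<Psi>: "sym_posdef \<Psi>" and \<Sigma>: "sym_posdef \<Sigma>" and s: "s > 0"
    and Z: "has_matrix_normal_law Q Z 0 (mat 1)"
  shows "has_matrix_normal_law Q (\<lambda>\<omega>. m + s *\<^sub>R (sym_sqrt \<Psi> ** Z \<omega> ** sym_sqrt \<Sigma>)) m (s\<^sup>2 *\<^sub>R kron \<Psi> \<Sigma>)"
proof -
  define A where "A = s *\<^sub>R kron (sym_sqrt \<Psi>) (sym_sqrt \<Sigma>)"
  have A: "invertible A"
    unfolding A_def using s kron_sym_sqrt(2)[OF \<Psi> \<Sigma>] by (intro scalar_invertible) auto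
  have AA: "A ** transpose A = s\<^sup>2 *\<^sub>R kron \<Psi> \<Sigma>"
    unfolding A_def transpose_scalar matrix_mult_scaleR kron_sym_sqrt(1)[OF \<Psi> \<Sigma>]
    by (simp add: power2_eq_square)
  have Zm[measurable]: "Z \<in> borel_measurable Q"
    and law: "distr Q borel (\<lambda>\<omega>. vec_cols (transpose (Z \<omega>))) = multivariate_normal 0 (mat 1)"
    using Z by (simp_all add: has_matrix_normal_law_def vec_cols_def transpose_def zero_vec_def)
  have vec: "vec_cols (transpose (m + s *\<^sub>R (sym_sqrt \<Psi> ** Z \<omega> ** sym_sqrt \<Sigma>)))
      = vec_cols (transpose m) + A *v vec_cols (transpose (Z \<omega>))" for \<omega>
  proof -
    have "vec_cols (transpose (m + s *\<^sub>R Y)) = vec_cols (transpose m) + s *\<^sub>R vec_cols (transpose Y)" for Y :: "real^'d^'nu"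
      by (simp add: vec_cols_def transpose_def vec_eq_iff)
    then show ?thesis
      by (simp add: vec_cols_transpose_mult kron_sym_sqrt(3)[OF \<Psi> \<Sigma>] A_def scaleR_matrix_vector_assoc)
  qed
  have "distr Q borel (\<lambda>\<omega>. vec_cols (transpose m) + A *v vec_cols (transpose (Z \<omega>)))
      = distr (distr Q borel (\<lambda>\<omega>. vec_cols (transpose (Z \<omega>)))) borel (\<lambda>z. vec_cols (transpose m) + A *v z)"
    by (subst distr_distr) (auto simp: comp_def intro: measurable_compose[OF Zm measurable_vec_cols_transpose])
  also have "\<dots> = multivariate_normal (vec_cols (transpose m)) (s\<^sup>2 *\<^sub>R kron \<Psi> \<Sigma>)"
    unfolding law AA[symmetric] by (rule distr_multivariate_normal_affine[OF A])
  finally have "distr Q borel (\<lambda>\<omega>. vec_cols (transpose (m + s *\<^sub>R (sym_sqrt \<Psi> ** Z \<omega> ** sym_sqrt \<Sigma>))))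
    = multivariate_normal (vec_cols (transpose m)) (s\<^sup>2 *\<^sub>R kron \<Psi> \<Sigma>)"
    by (simp only: vec)
  moreover have "(\<lambda>\<omega>. m + s *\<^sub>R (sym_sqrt \<Psi> ** Z \<omega> ** sym_sqrt \<Sigma>)) \<in> borel_measurable Q"
    by (intro borel_measurable_add borel_measurable_scaleR borel_measurable_const
        measurable_compose[OF Zm borel_measurable_linear[OF bounded_linear.linear[OF bounded_linear_matrix_sandwich]]])
  ultimately show ?thesis
    by (simp add: has_matrix_normal_law_def)
qed

lemma has_matrix_normal_law_AE_cong:
  assumes "has_matrix_normal_law Q Y m C" and "AE \<omega> in Q. X \<omega> = Y \<omega>" and "X \<in> borel_measurable Q"
  shows "has_matrix_normal_law Q X m C"
  using assms distr_cong_AE[OF refl refl assms(2) assms(3)] by (auto simp: has_matrix_normal_law_iff)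

lemma sets_matrix_normal [simp, measurable_cong]: "sets (matrix_normal m C) = sets borel"
  and space_matrix_normal [simp]: "space (matrix_normal m C) = UNIV"
  by (simp_all add: matrix_normal_def)

text \<open>The vector statement transported along the bijection between matrices and stacked
  vectors, with \<open>E\<close> replaced by its preimage \<open>E'\<close>.\<close>

theorem matrix_normal_invariant:
  fixes \<Psi> :: "real^'nu^'nu" and \<Sigma> :: "real^'d^'d" and a b :: real
  assumes \<Psi>: "sym_posdef \<Psi>" and \<Sigma>: "sym_posdef \<Sigma>" and b: "b > 0" and ab: "a\<^sup>2 + b\<^sup>2 = 1"
    and E: "E \<in> sets borel"
  shows "(\<integral>\<^sup>+x. emeasure (matrix_normal (a *\<^sub>R x) (b\<^sup>2 *\<^sub>R kron \<Psi> \<Sigma>)) E \<partial>matrix_normal 0 (kron \<Psi> \<Sigma>))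
    = emeasure (matrix_normal 0 (kron \<Psi> \<Sigma>)) E"
proof -
  define A where "A = kron (sym_sqrt \<Psi>) (sym_sqrt \<Sigma>)"
  have A: "invertible A" and AA: "A ** transpose A = kron \<Psi> \<Sigma>"
    using kron_sym_sqrt[OF \<Psi> \<Sigma>] by (simp_all add: A_def)
  have bAA: "(b *\<^sub>R A) ** transpose (b *\<^sub>R A) = b\<^sup>2 *\<^sub>R kron \<Psi> \<Sigma>"
    unfolding transpose_scalar matrix_mult_scaleR AA by (simp add: power2_eq_square)
  let ?u = "\<lambda>v :: real^('nu \<times> 'd). \<chi> i j. v $ (i, j)"
  have [measurable]: "?u \<in> borel_measurable borel"
    by (rule measurable_unvec)
  define E' where "E' = ?u -` E"
  have E': "E' \<in> sets borel"
    using measurable_sets[OF measurable_unvec E] by (simp add: E'_def)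
  have em: "emeasure (matrix_normal m C) E = emeasure (multivariate_normal (vec_cols (transpose m)) C) E'" for m C
    unfolding matrix_normal_def by (subst emeasure_distr) (auto simp: E E'_def)
  have zero: "vec_cols (transpose (0 :: real^'d^'nu)) = 0"
    by (simp add: vec_cols_def transpose_def zero_vec_def)
  have vu: "vec_cols (transpose (a *\<^sub>R ?u v)) = a *\<^sub>R v" for v
    by (simp add: vec_cols_def transpose_def vec_eq_iff)
  have meas: "(\<lambda>x::real^'d^'nu. emeasure (multivariate_normal (a *\<^sub>R vec_cols (transpose x)) (b\<^sup>2 *\<^sub>R kron \<Psi> \<Sigma>)) E')
      \<in> borel_measurable borel"
    by (rule measurable_compose[OF measurable_vec_cols_transpose measurable_emeasure_multivariate_normal[OF E']])
  have "(\<integral>\<^sup>+x. emeasure (matrix_normal (a *\<^sub>R x) (b\<^sup>2 *\<^sub>R kron \<Psi> \<Sigma>)) E \<partial>matrix_normal 0 (kron \<Psi> \<Sigma>))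
      = (\<integral>\<^sup>+x. emeasure (multivariate_normal (a *\<^sub>R vec_cols (transpose x)) (b\<^sup>2 *\<^sub>R kron \<Psi> \<Sigma>)) E' \<partial>matrix_normal 0 (kron \<Psi> \<Sigma>))"
    by (simp add: em vec_cols_def transpose_def scaleR_vec_def)
  also have "\<dots> = (\<integral>\<^sup>+v. emeasure (multivariate_normal (a *\<^sub>R v) (b\<^sup>2 *\<^sub>R kron \<Psi> \<Sigma>)) E' \<partial>multivariate_normal 0 (kron \<Psi> \<Sigma>))"
    unfolding matrix_normal_def zero
    using meas by (subst nn_integral_distr) (simp_all add: vec_cols_def transpose_def)
  also have "\<dots> = emeasure (multivariate_normal 0 (kron \<Psi> \<Sigma>)) E'"
    unfolding AA[symmetric] bAA[symmetric, unfolded AA[symmetric]]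
    using nn_integral_multivariate_normal_kernel[OF A b ab E'] by (simp add: AA bAA)
  finally show ?thesis
    by (simp add: em zero)
qed

lemma prob_space_matrix_normal_std: "prob_space (matrix_normal (0 :: real^'b^'a) (mat 1))"
  unfolding matrix_normal_def
proof (rule prob_space.prob_space_distr)
  have "invertible (mat 1 :: real^('a \<times> 'b)^('a \<times> 'b))"
    by (auto simp: invertible_def)
  from prob_space_multivariate_normal[OF this]
  show "prob_space (multivariate_normal (vec_cols (transpose (0 :: real^'b^'a))) (mat 1))"
    by simp
qed (subst measurable_cong_sets[OF sets_multivariate_normal refl], rule measurable_unvec)

lemma borel_measurable_OU_map:
  fixes m :: "real^'d^'nu"
  shows "(\<lambda>z. m + s *\<^sub>R (P ** z ** S)) \<in> borel_measurable borel"
  by (intro borel_measurable_add borel_measurable_scaleR borel_measurable_const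
      borel_measurable_linear bounded_linear.linear[OF bounded_linear_matrix_sandwich])

text \<open>Stating the law as an image of the standard one, not as a normal law, lets it include t
  = 0, where the map is constant and the law is the point mass at \<open>x\<close>.\<close>

lemma distr_matrix_OU_solution:
  fixes x :: "real^'d^'nu"
  assumes \<Psi>: "sym_posdef \<Psi>" and \<Sigma>: "sym_posdef \<Sigma>" and M: "prob_space M" and B: "matrix_brownian_motion M B"
    and X: "matrix_OU_solution M B \<Psi> \<Sigma> x X" and t: "t \<ge> 0"
  shows "distr M borel (X t) = distr (matrix_normal 0 (mat 1)) borel
    (\<lambda>z. exp (- t) *\<^sub>R x + sqrt (1 - exp (- 2 * t)) *\<^sub>R (sym_sqrt \<Psi> ** z ** sym_sqrt \<Sigma>))"
    (is "_ = distr _ _ ?\<phi>")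
proof (cases "t = 0")
  case True
  interpret prob_space M by (rule M)
  have "prob_space (matrix_normal 0 (mat 1) :: (real^'d^'nu) measure)"
    by (rule prob_space_matrix_normal_std)
  from prob_space.distr_const[OF this, of x borel]
  have "distr (matrix_normal 0 (mat 1) :: (real^'d^'nu) measure) borel (\<lambda>_. x) = return borel x"
    by simp
  moreover have "distr M borel (X 0) = distr M borel (\<lambda>_. x)"
    using X by (intro distr_cong_AE) (auto simp: matrix_OU_solution_def)
  ultimately show ?thesis
    using True by simp
next
  case False
  then have "t > 0"
    using t by simp
  then obtain Z where Z: "has_matrix_normal_law M Z 0 (mat 1)" and XZ: "AE \<omega> in M. X t \<omega> = ?\<phi> (Z \<omega>)"
    by (rule matrix_OU_solution_representation[OF \<Psi> \<Sigma> M B X])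
  have Zm[measurable]: "Z \<in> borel_measurable M" and law: "distr M borel Z = matrix_normal 0 (mat 1)"
    using Z by (simp_all add: has_matrix_normal_law_iff)
  have "distr M borel (X t) = distr M borel (\<lambda>\<omega>. ?\<phi> (Z \<omega>))"
    using X t XZ measurable_compose[OF Zm borel_measurable_OU_map]
    by (intro distr_cong_AE) (auto simp: matrix_OU_solution_def)
  also have "\<dots> = distr (distr M borel Z) borel ?\<phi>"
    by (subst distr_distr) (auto simp: comp_def borel_measurable_OU_map)
  finally show ?thesis
    by (simp add: law)
qed

lemma matrix_OU_solution_normal_law:
  assumes \<Psi>: "sym_posdef \<Psi>" and \<Sigma>: "sym_posdef \<Sigma>" and M: "prob_space M" and B: "matrix_brownian_motion M B"
    and X: "matrix_OU_solution M B \<Psi> \<Sigma> x X" and t: "t > 0"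
  shows "has_matrix_normal_law M (X t) (exp (- t) *\<^sub>R x) ((1 - exp (- 2 * t)) *\<^sub>R kron \<Psi> \<Sigma>)"
proof -
  obtain Z where Z: "has_matrix_normal_law M Z 0 (mat 1)" and XZ: "AE \<omega> in M. X t \<omega>
      = exp (- t) *\<^sub>R x + sqrt (1 - exp (- 2 * t)) *\<^sub>R (sym_sqrt \<Psi> ** Z \<omega> ** sym_sqrt \<Sigma>)"
    by (rule matrix_OU_solution_representation[OF \<Psi> \<Sigma> M B X t])
  have "sqrt (1 - exp (- 2 * t)) > 0" "(sqrt (1 - exp (- 2 * t)))\<^sup>2 = 1 - exp (- 2 * t)"
    using t by auto
  with has_matrix_normal_law_AE_cong[OF has_matrix_normal_law_affine[OF \<Psi> \<Sigma> _ Z] XZ] X t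
  show ?thesis
    by (simp add: matrix_OU_solution_def)
qed

theorem proposition2:
  fixes \<Psi> :: "real^'nu^'nu" and \<Sigma> :: "real^'d^'d"
    and M :: "'w measure" and B :: "real \<Rightarrow> 'w \<Rightarrow> real^'d^'nu"
    and X :: "real^'d^'nu \<Rightarrow> real \<Rightarrow> 'w \<Rightarrow> real^'d^'nu"
  assumes "sym_posdef \<Psi>" and "sym_posdef \<Sigma>"
    and "prob_space M" and "matrix_brownian_motion M B"
    and "\<And>x. matrix_OU_solution M B \<Psi> \<Sigma> x (X x)"
  shows
    "(\<forall>x. \<forall>t>0. has_matrix_normal_law M (X x t)
        (exp (- t) *\<^sub>R x) ((1 - exp (- 2 * t)) *\<^sub>R kron \<Psi> \<Sigma>))
     \<and> (\<forall>x. converges_in_law (\<lambda>t. distr M borel (X x t)) (matrix_normal 0 (kron \<Psi> \<Sigma>)) at_top)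
     \<and> (\<forall>(Q :: 'v measure) Z. prob_space Q \<and> has_matrix_normal_law Q Z 0 (kron (mat 1) (mat 1)) \<longrightarrow>
         (\<forall>t\<ge>0. \<forall>x. \<forall>h \<in> borel_measurable borel.
          integrable Q (\<lambda>\<omega>. h (exp (- t) *\<^sub>R x
             + sqrt (1 - exp (- 2 * t)) *\<^sub>R (sym_sqrt \<Psi> ** Z \<omega> ** sym_sqrt \<Sigma>))) \<longrightarrow>
          integrable (transition_kernel M X t x) h \<and>
          semigroup_op (transition_kernel M X) t h x =
            prob_space.expectation Q (\<lambda>\<omega>. h (exp (- t) *\<^sub>R x
              + sqrt (1 - exp (- 2 * t)) *\<^sub>R (sym_sqrt \<Psi> ** Z \<omega> ** sym_sqrt \<Sigma>)))))
     \<and> (\<forall>t\<ge>0. measure_semigroup (matrix_normal 0 (kron \<Psi> \<Sigma>)) (transition_kernel M X) t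
          = matrix_normal 0 (kron \<Psi> \<Sigma>))"
proof (intro conjI allI impI ballI)
  \<comment> \<open>One fixed standard law \<open>\<gamma>\<close> carries the marginal laws of
    \<open>X x t\<close> for all \<open>t\<close> and \<open>x\<close> as images under
    \<open>\<phi> t x\<close>. Convergence in law thereby becomes pointwise convergence of
    \<open>\<phi> t x\<close> under a single integral.\<close>
  define \<gamma> where "\<gamma> = (matrix_normal 0 (mat 1) :: (real^'d^'nu) measure)"
  define \<phi> where "\<phi> t x z = exp (- t) *\<^sub>R x + sqrt (1 - exp (- 2 * t)) *\<^sub>R (sym_sqrt \<Psi> ** z ** sym_sqrt \<Sigma>)"
    for t :: real and x z :: "real^'d^'nu"
  interpret \<gamma>: prob_space \<gamma>
    unfolding \<gamma>_def by (rule prob_space_matrix_normal_std)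
  have sets_\<gamma>[simp, measurable_cong]: "sets \<gamma> = sets borel"
    by (simp add: \<gamma>_def)
  have \<phi>[measurable]: "\<phi> t x \<in> borel_measurable borel" for t x
    unfolding \<phi>_def[abs_def] by (rule borel_measurable_OU_map)
  have law: "distr M borel (X x t) = distr \<gamma> borel (\<phi> t x)" if "t \<ge> 0" for x t
    using distr_matrix_OU_solution[OF assms that] by (simp add: \<gamma>_def \<phi>_def[abs_def])
  show normal: "has_matrix_normal_law M (X x t) (exp (- t) *\<^sub>R x) ((1 - exp (- 2 * t)) *\<^sub>R kron \<Psi> \<Sigma>)"
    if "t > 0" for x t
    by (rule matrix_OU_solution_normal_law[OF assms that])
  have "has_matrix_normal_law \<gamma> (\<lambda>z. z) 0 (mat 1)"
    by (simp add: has_matrix_normal_law_iff) (simp add: distr_id2 \<gamma>_def)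
  \<comment> \<open>Scale 1 and mean 0 give the pointwise limit of \<open>\<phi> t x\<close> as t
    grows, so the limit law is an image of \<open>\<gamma>\<close> as well.\<close>
  from has_matrix_normal_law_affine[OF assms(1,2) _ this, of 1 0]
  have lim_law: "distr \<gamma> borel (\<lambda>z. sym_sqrt \<Psi> ** z ** sym_sqrt \<Sigma>) = matrix_normal 0 (kron \<Psi> \<Sigma>)"
    and [measurable]: "(\<lambda>z. sym_sqrt \<Psi> ** z ** sym_sqrt \<Sigma>) \<in> borel_measurable \<gamma>"
    by (simp_all add: has_matrix_normal_law_iff)
  show "converges_in_law (\<lambda>t. distr M borel (X x t)) (matrix_normal 0 (kron \<Psi> \<Sigma>)) at_top" for x
    unfolding converges_in_law_def
  proof (intro allI impI)
    fix f :: "real^'d^'nu \<Rightarrow> real"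
    assume f: "continuous_on UNIV f \<and> bounded (range f)"
    then have [measurable]: "f \<in> borel_measurable borel"
      by (intro borel_measurable_continuous_onI) auto
    obtain K where K: "\<And>y. norm (f y) \<le> K"
      using f by (auto simp: bounded_iff)
    have "((\<lambda>t. \<integral>z. f (\<phi> t x z) \<partial>\<gamma>) \<longlongrightarrow> (\<integral>z. f (sym_sqrt \<Psi> ** z ** sym_sqrt \<Sigma>) \<partial>\<gamma>)) at_top"
    proof (rule integral_dominated_convergence_at_top)
      show "AE z in \<gamma>. ((\<lambda>t. f (\<phi> t x z)) \<longlongrightarrow> f (sym_sqrt \<Psi> ** z ** sym_sqrt \<Sigma>)) at_top"
      proof (rule AE_I2)
        fix z
        have "((\<lambda>t. exp (- t)) \<longlongrightarrow> (0::real)) at_top" "((\<lambda>t. sqrt (1 - exp (- 2 * t))) \<longlongrightarrow> 1) at_top"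
          by real_asymp+
        then have "((\<lambda>t. \<phi> t x z) \<longlongrightarrow> 0 *\<^sub>R x + 1 *\<^sub>R (sym_sqrt \<Psi> ** z ** sym_sqrt \<Sigma>)) at_top"
          unfolding \<phi>_def by (intro tendsto_intros)
        then show "((\<lambda>t. f (\<phi> t x z)) \<longlongrightarrow> f (sym_sqrt \<Psi> ** z ** sym_sqrt \<Sigma>)) at_top"
          using f by (auto intro: continuous_on_tendsto_compose[of UNIV])
      qed
      show "\<forall>\<^sub>F t in at_top. AE z in \<gamma>. norm (f (\<phi> t x z)) \<le> K"
        using K by simp
    qed auto
    moreover have "\<forall>\<^sub>F t in at_top. (\<integral>z. f (\<phi> t x z) \<partial>\<gamma>) = (\<integral>y. f y \<partial>distr M borel (X x t))"
      using eventually_ge_at_top[of 0] by eventually_elim (simp add: law integral_distr)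
    ultimately show "((\<lambda>t. \<integral>y. f y \<partial>distr M borel (X x t)) \<longlongrightarrow> (\<integral>y. f y \<partial>matrix_normal 0 (kron \<Psi> \<Sigma>))) at_top"
      unfolding lim_law[symmetric] by (subst integral_distr) (auto intro: Lim_transform_eventually)
  qed
  {
    fix Q :: "'v measure" and Z t x and h :: "real^'d^'nu \<Rightarrow> real"
    assume Z: "prob_space Q \<and> has_matrix_normal_law Q Z 0 (kron (mat 1) (mat 1))" and t: "0 \<le> t"
      and h[measurable]: "h \<in> borel_measurable borel"
      and int: "integrable Q (\<lambda>\<omega>. h (exp (- t) *\<^sub>R x + sqrt (1 - exp (- 2 * t)) *\<^sub>R (sym_sqrt \<Psi> ** Z \<omega> ** sym_sqrt \<Sigma>)))"
    have [measurable]: "Z \<in> borel_measurable Q" and "distr Q borel Z = \<gamma>"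
      using Z by (simp_all add: has_matrix_normal_law_iff kron_mat_1 \<gamma>_def)
    then have K: "transition_kernel M X t x = distr Q borel (\<lambda>\<omega>. \<phi> t x (Z \<omega>))"
      by (simp add: transition_kernel_def law[OF t] distr_distr comp_def flip: \<open>distr Q borel Z = \<gamma>\<close>)
    show "integrable (transition_kernel M X t x) h"
      unfolding K using int by (subst integrable_distr_eq) (simp_all add: \<phi>_def)
    show "semigroup_op (transition_kernel M X) t h x = prob_space.expectation Q (\<lambda>\<omega>. h (exp (- t) *\<^sub>R x
        + sqrt (1 - exp (- 2 * t)) *\<^sub>R (sym_sqrt \<Psi> ** Z \<omega> ** sym_sqrt \<Sigma>)))"
      unfolding semigroup_op_def K by (subst integral_distr) (simp_all add: \<phi>_def)
  }
  fix t :: real assume t: "0 \<le> t"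
  let ?\<gamma> = "matrix_normal 0 (kron \<Psi> \<Sigma>)"
  have "(\<integral>\<^sup>+x. emeasure (transition_kernel M X t x) E \<partial>?\<gamma>) = emeasure ?\<gamma> E" if E: "E \<in> sets borel" for E
  proof (cases "t = 0")
    case True
    have "transition_kernel M X t x = return borel x" for x
      using \<gamma>.distr_const[of x borel] by (simp add: transition_kernel_def law True \<phi>_def[abs_def])
    then show ?thesis
      using E by simp
  next
    case False
    with t have t: "t > 0"
      by simp
    \<comment> \<open>The variance factor is written as a square to expose
      \<open>b = sqrt (1 - exp (- 2 * t))\<close>, which complements \<open>a = exp (- t)\<close> to
      a^2 + b^2 = 1.\<close>
    have K: "transition_kernel M X t x = matrix_normal (exp (- t) *\<^sub>R x) ((sqrt (1 - exp (- 2 * t)))\<^sup>2 *\<^sub>R kron \<Psi> \<Sigma>)" for x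
      using normal[OF t, of x] t by (simp add: transition_kernel_def has_matrix_normal_law_iff)
    show ?thesis
      unfolding K
    proof (rule matrix_normal_invariant[OF assms(1,2) _ _ E])
      show "(exp (- t))\<^sup>2 + (sqrt (1 - exp (- 2 * t)))\<^sup>2 = 1"
        using t by (simp add: exp_double[symmetric])
    qed (use t in auto)
  qed
  \<comment> \<open>\<open>measure_of\<close> depends on its set function only through the values on
    Borel sets, and there the two functions agree.\<close>
  then have "measure_semigroup ?\<gamma> (transition_kernel M X) t = measure_of UNIV (sets borel) (emeasure ?\<gamma>)"
    unfolding measure_semigroup_def
    by (intro measure_of_eq) (auto simp: sets.sigma_sets_eq[of borel, simplified])
  also have "\<dots> = ?\<gamma>"
    using measure_of_of_measure[of ?\<gamma>] by simp
  finally show "measure_semigroup ?\<gamma> (transition_kernel M X) t = ?\<gamma>" .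
qed

end
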